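(* Let $k,m\geq1$, $n=k+m$, $\gamma\geq 0$, and write $(x,y)=(x_1,\dots,x_m,y_1,\dots,y_k)\in\mathbb{R}^m\times\mathbb{R}^k=\mathbb{R}^n$. Let $Q=m+(1+\gamma)k$ and let $\alpha_1,\alpha_2\in\mathbb{R}$ be such that $$Q+\alpha_1-2>0\quad\text{and}\quad m+\gamma\alpha_2>0.$$ Then for all complex-valued functions $f\in C_0^\infty(\mathbb{R}^n\setminus\{0\})$ we have $$\int_{\mathbb{R}^n}\rho^{\alpha_1}|\nabla_\gamma\rho|^{\alpha_2}\left(\left|\frac{d}{d|x|}f\right|^2+|x|^{2\gamma}|\nabla_yf|^2\right)dxdy\geq\left(\frac{Q+\alpha_1-2}{2}\right)^2\int_{\mathbb{R}^n}\rho^{\alpha_1}|\nabla_\gamma\rho|^{\alpha_2}\frac{|\nabla_\gamma\rho|^2}{\rho^2}|f|^2\,dxdy,$$ with sharp constant $\left(\frac{Q+\alpha_1-2}{2}\right)^2$ (it cannot be replaced by a larger constant valid for all such $f$).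
   Context: $|x|$ and $|y|$ denote Euclidean norms. The function $\rho$ on $\mathbb{R}^m\times\mathbb{R}^k$ is $$\rho=\rho(x,y)=\left(|x|^{2(1+\gamma)}+(1+\gamma)^2|y|^2\right)^{\frac{1}{2(1+\gamma)}}.$$ The Baouendi-Grushin gradient is $\nabla_\gamma=(\nabla_x,|x|^\gamma\nabla_y)$, where $\nabla_x$, $\nabla_y$ are the gradients in $x$ and $y$; one has $|\nabla_\gamma\rho|=|x|^\gamma/\rho^\gamma$. The radial derivative in $x$ is $\frac{d}{d|x|}f=\frac{x}{|x|}\cdot\nabla_xf$. *)

theory Defs
  imports "HOL-Analysis.Analysis"
begin

section \<open>Smooth functions with compact support\<close>

text \<open>
  In finite dimension \<open>Ck_on k S f\<close>, for open \<open>S\<close>, is the usual class of \<open>k\<close> times continuously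
  differentiable functions: all iterated directional derivatives of order at most \<open>k\<close> exist
  and are continuous.
\<close>

primrec Ck_on :: "nat \<Rightarrow> 'a::euclidean_space set \<Rightarrow> ('a \<Rightarrow> 'b::real_normed_vector) \<Rightarrow> bool" where
  "Ck_on 0 S f \<longleftrightarrow> continuous_on S f"
| "Ck_on (Suc k) S f \<longleftrightarrow>
     (\<forall>z\<in>S. f differentiable (at z)) \<and> (\<forall>v. Ck_on k S (\<lambda>z. frechet_derivative f (at z) v))"

definition smooth_on :: "'a::euclidean_space set \<Rightarrow> ('a \<Rightarrow> 'b::real_normed_vector) \<Rightarrow> bool" where
  "smooth_on S f \<longleftrightarrow> (\<forall>k. Ck_on k S f)"

text \<open>
  Functions on an open set \<open>S\<close> are represented by their extension by zero to the whole space.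
\<close>

definition test_function_on ::
    "'a::euclidean_space set \<Rightarrow> ('a \<Rightarrow> 'b::real_normed_vector) \<Rightarrow> bool" where
  "test_function_on S f \<longleftrightarrow>
     smooth_on S f \<and> compact (closure {z. f z \<noteq> 0}) \<and> closure {z. f z \<noteq> 0} \<subseteq> S"


section \<open>The Baouendi-Grushin gradient\<close>

definition grad_x ::
    "((real^'m) \<times> (real^'k) \<Rightarrow> 'b::real_normed_vector) \<Rightarrow> (real^'m) \<times> (real^'k) \<Rightarrow> 'b^'m" where
  "grad_x f z = (\<chi> i. frechet_derivative f (at z) (axis i 1, 0))"

definition grad_y ::
    "((real^'m) \<times> (real^'k) \<Rightarrow> 'b::real_normed_vector) \<Rightarrow> (real^'m) \<times> (real^'k) \<Rightarrow> 'b^'k" where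
  "grad_y f z = (\<chi> j. frechet_derivative f (at z) (0, axis j 1))"

text \<open>
  In HOL \<open>0 powr a = 0\<close> for every \<open>a\<close>, and \<open>x /\<^sub>R norm x = 0\<close> for \<open>x = 0\<close>. Together with the
  point where \<open>\<rho>\<close> may fail to be differentiable, this only affects values on the null set
  \<open>{(x, y). x = 0}\<close>.
\<close>

definition grushin_grad ::
    "real \<Rightarrow> ((real^'m) \<times> (real^'k) \<Rightarrow> 'b::real_normed_vector) \<Rightarrow> (real^'m) \<times> (real^'k) \<Rightarrow> ('b^'m) \<times> ('b^'k)"
  where
  "grushin_grad \<gamma> f z = (grad_x f z, (norm (fst z) powr \<gamma>) *\<^sub>R grad_y f z)"

definition radial_deriv_x ::
    "((real^'m) \<times> (real^'k) \<Rightarrow> 'b::real_normed_vector) \<Rightarrow> (real^'m) \<times> (real^'k) \<Rightarrow> 'b" where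
  "radial_deriv_x f z = (\<Sum>i\<in>UNIV. (fst z /\<^sub>R norm (fst z)) $ i *\<^sub>R grad_x f z $ i)"

definition rho :: "real \<Rightarrow> (real^'m) \<times> (real^'k) \<Rightarrow> real" where
  "rho \<gamma> z = (norm (fst z) powr (2 * (1 + \<gamma>)) + (1 + \<gamma>)\<^sup>2 * (norm (snd z))\<^sup>2)
                powr (1 / (2 * (1 + \<gamma>)))"


section \<open>The two sides of the inequality\<close>

text \<open>
  Both integrands are nonnegative, so the integrals are taken in \<open>[0, \<infinity>]\<close>; this avoids the
  convention that the Bochner integral of a non-integrable function is \<open>0\<close>.
\<close>

definition hardy_weight :: "real \<Rightarrow> real \<Rightarrow> real \<Rightarrow> (real^'m) \<times> (real^'k) \<Rightarrow> real" where
  "hardy_weight \<gamma> \<alpha>\<^sub>1 \<alpha>\<^sub>2 z = rho \<gamma> z powr \<alpha>\<^sub>1 * norm (grushin_grad \<gamma> (rho \<gamma>) z) powr \<alpha>\<^sub>2"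

definition hardy_energy ::
    "real \<Rightarrow> real \<Rightarrow> real \<Rightarrow> ((real^'m) \<times> (real^'k) \<Rightarrow> complex) \<Rightarrow> ennreal" where
  "hardy_energy \<gamma> \<alpha>\<^sub>1 \<alpha>\<^sub>2 f =
     (\<integral>\<^sup>+ z. ennreal (hardy_weight \<gamma> \<alpha>\<^sub>1 \<alpha>\<^sub>2 z *
        ((cmod (radial_deriv_x f z))\<^sup>2
          + norm (fst z) powr (2 * \<gamma>) * (norm (grad_y f z))\<^sup>2)) \<partial>lborel)"

definition hardy_mass ::
    "real \<Rightarrow> real \<Rightarrow> real \<Rightarrow> ((real^'m) \<times> (real^'k) \<Rightarrow> complex) \<Rightarrow> ennreal" where
  "hardy_mass \<gamma> \<alpha>\<^sub>1 \<alpha>\<^sub>2 f =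
     (\<integral>\<^sup>+ z. ennreal (hardy_weight \<gamma> \<alpha>\<^sub>1 \<alpha>\<^sub>2 z *
        ((norm (grushin_grad \<gamma> (rho \<gamma>) z))\<^sup>2 / (rho \<gamma> z)\<^sup>2) * (cmod (f z))\<^sup>2) \<partial>lborel)"

end

theory Submission
  imports Defs "HOL-Real_Asymp.Real_Asymp"
begin

text \<open>
  The weights and the gauge \<open>\<rho>\<close> are homogeneous under the dilations
  \<open>\<delta>\<^sub>t (x, y) = (e\<^sup>t x, e\<^bsup>(1+\<gamma>)t\<^esup> y)\<close>, whose Jacobian is \<open>e\<^bsup>Qt\<^esup>\<close>. Write \<open>Z f (x, y) = Df (x, (1+\<gamma>) y)\<close> for
  the derivative of \<open>f\<close> along this flow, \<open>D = Q + \<alpha>\<^sub>1 - 2\<close>, and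
  \<open>W = \<rho>\<^bsup>\<alpha>\<^sub>1\<^esup> |\<nabla>\<^sub>\<gamma>\<rho>|\<^bsup>\<alpha>\<^sub>2\<^esup> |\<nabla>\<^sub>\<gamma>\<rho>|\<^sup>2 / \<rho>\<^sup>2\<close> for the weight on the right-hand side. Off the null set \<open>x = 0\<close> the
  weight \<open>W\<close> is a power of \<open>\<rho>\<close> times a power of \<open>|x|\<close>, homogeneous of degree \<open>\<alpha>\<^sub>1 - 2\<close>, so composing
  a function with \<open>\<delta>\<^sub>t\<close> multiplies its integral against \<open>W dz\<close> by \<open>e\<^bsup>-Dt\<^esup>\<close>.

  \<^bold>\<open>The inequality.\<close> Since \<open>x \<cdot> \<nabla>\<^sub>x f = |x| df/d|x|\<close>, the Cauchy-Schwarz inequality bounds the energy density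
  below by \<open>|\<nabla>\<^sub>\<gamma>\<rho>|\<^sup>2 / \<rho>\<^sup>2 |Z f|\<^sup>2\<close> (\<open>energy_density_ge\<close>), and it remains to show
  \<open>(D/2)\<^sup>2 \<integral> W |f|\<^sup>2 \<le> \<integral> W |Z f|\<^sup>2\<close>. On each orbit \<open>\<phi>(s) = f (\<delta>\<^sub>s z)\<close> vanishes for large \<open>s\<close>, and integrating
  \<open>-(e\<^bsup>as\<^esup> |\<phi>|\<^sup>2)' \<le> e\<^bsup>as\<^esup> |\<phi>'|\<^sup>2 / a\<close> gives \<open>|f z|\<^sup>2 \<le> (1/a) \<integral>\<^sub>0\<^sup>\<infinity> e\<^bsup>as\<^esup> |Z f (\<delta>\<^sub>s z)|\<^sup>2 ds\<close>. Integrating this against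
  \<open>W dz\<close>, exchanging the integrals and rescaling yields the factor \<open>1 / (a (D - a))\<close>, which for
  \<open>a = D/2\<close> is \<open>(2/D)\<^sup>2\<close> (\<open>nn_integral_hardy\<close>).

  \<^bold>\<open>Sharpness.\<close> For functions \<open>u (ln \<rho>)\<close> both estimates lose little when \<open>u\<close> is a long cut-off of
  \<open>e\<^bsup>-Ds/2\<^esup>\<close>. Homogeneity alone gives the polar formula \<open>\<integral> W G(ln \<rho>) dz = c \<integral> G(s) e\<^bsup>Ds\<^esup> ds\<close>
  (\<open>nn_integral_polar\<close>), and so both sides become one-dimensional integrals whose ratio tends to \<open>(D/2)\<^sup>2\<close>
  (\<open>ex_profile_nearly_optimal\<close>). As \<open>\<rho>\<close> need not be smooth where \<open>x = 0\<close>, it is replaced by the smooth gauges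
  obtained from \<open>|x|\<^sup>2 + \<epsilon>\<^sup>2\<close> in place of \<open>|x|\<^sup>2\<close>; dominated convergence carries a hypothetical better
  constant over to the limit \<open>\<epsilon> \<rightarrow> 0\<close> (\<open>hardy_constant_bounds_profile\<close>). The majorant is the weight
  \<open>\<rho>\<^bsup>\<alpha>\<^sub>1\<^esup> |\<nabla>\<^sub>\<gamma>\<rho>|\<^bsup>\<alpha>\<^sub>2\<^esup>\<close> on a sublevel set of \<open>\<rho>\<close>. Near points \<open>(0, y)\<close> with \<open>y \<noteq> 0\<close> it behaves like
  \<open>|x|\<^bsup>\<gamma>\<alpha>\<^sub>2\<^esup>\<close>, which is integrable as \<open>m + \<gamma> \<alpha>\<^sub>2 > 0\<close>, and near the origin it is integrable by homogeneity,
  as \<open>Q + \<alpha>\<^sub>1 > 0\<close>.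
\<close>

section \<open>Measures that are homogeneous under a dilation group\<close>

text \<open>
  The number \<open>D\<close> is the homogeneous dimension of the measure. Stating the scaling law for nonnegative integrals
  of arbitrary measurable functions means that no integrability has to be checked when it is used.
\<close>

locale dilation_measure = sigma_finite_measure M for M :: "'a measure" +
  fixes \<delta> :: "real \<Rightarrow> 'a \<Rightarrow> 'a" and D :: real
  assumes measurable_dilation [measurable]: "case_prod \<delta> \<in> borel \<Otimes>\<^sub>M M \<rightarrow>\<^sub>M M"
    and nn_integral_dilation:
      "F \<in> borel_measurable M \<Longrightarrow> (\<integral>\<^sup>+z. F (\<delta> t z) \<partial>M) = ennreal (exp (-(D*t))) * (\<integral>\<^sup>+z. F z \<partial>M)"
begin

text \<open>
  Polar coordinates without a sphere: \<open>\<l>\<close> plays the role of the logarithm of a homogeneous gauge, and the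
  first factor on the right is the mass of the unit sphere. The proof only uses Tonelli's theorem.
  Inserting \<open>1 = \<integral> 1\<^bsub>[0,1]\<^esub>(\<l> z + t) dt\<close> and dilating by \<open>t\<close> moves the whole dependence on \<open>G\<close> into an
  integral over \<open>t\<close>, while \<open>z\<close> stays in the shell \<open>0 \<le> \<l> z \<le> 1\<close>.
\<close>

lemma nn_integral_polar:
  fixes \<l> :: "'a \<Rightarrow> real" and G :: "real \<Rightarrow> ennreal"
  assumes [measurable]: "\<l> \<in> borel_measurable M" "G \<in> borel_measurable borel"
    and \<l>: "\<And>t. AE z in M. \<l> (\<delta> t z) = \<l> z + t"
  shows "(\<integral>\<^sup>+z. G (\<l> z) \<partial>M) =
    (\<integral>\<^sup>+z. indicator {0..1} (\<l> z) * ennreal (exp (-(D * \<l> z))) \<partial>M) * (\<integral>\<^sup>+s. G s * ennreal (exp (D * s)) \<partial>lborel)"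
proof -
  interpret pair_sigma_finite M "lborel :: real measure"
    by (intro pair_sigma_finite.intro sigma_finite_measure_axioms sigma_finite_lborel)
  let ?I = "indicator {0..1::real} :: real \<Rightarrow> ennreal"
  have unit: "(\<integral>\<^sup>+t. ?I (a + t) \<partial>lborel) = 1" for a
  proof -
    have "(\<integral>\<^sup>+t. ?I (a + t) \<partial>lborel) = (\<integral>\<^sup>+t. ?I t \<partial>lborel)"
      using nn_integral_real_affine[of ?I 1 a] by simp
    then show ?thesis by simp
  qed
  \<comment> \<open>Insert the unit integral, then express the integrand through the dilated point.\<close>
  have "(\<integral>\<^sup>+z. G (\<l> z) \<partial>M) = (\<integral>\<^sup>+z. (\<integral>\<^sup>+t. G (\<l> z) * ?I (\<l> z + t) \<partial>lborel) \<partial>M)"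
    by (simp add: nn_integral_cmult unit)
  also have "\<dots> = (\<integral>\<^sup>+t. (\<integral>\<^sup>+z. G (\<l> z) * ?I (\<l> z + t) \<partial>M) \<partial>lborel)"
    by (rule Fubini'[symmetric]) measurable
  also have "\<dots> = (\<integral>\<^sup>+t. (\<integral>\<^sup>+z. G (\<l> (\<delta> t z) - t) * ?I (\<l> (\<delta> t z)) \<partial>M) \<partial>lborel)"
  proof (rule nn_integral_cong, rule nn_integral_cong_AE)
    fix t show "AE z in M. G (\<l> z) * ?I (\<l> z + t) = G (\<l> (\<delta> t z) - t) * ?I (\<l> (\<delta> t z))"
      using \<l>[of t] by eventually_elim simp
  qed
  also have "\<dots> = (\<integral>\<^sup>+t. ennreal (exp (-(D*t))) * (\<integral>\<^sup>+z. G (\<l> z - t) * ?I (\<l> z) \<partial>M) \<partial>lborel)"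
  proof (intro nn_integral_cong)
    fix t show "(\<integral>\<^sup>+z. G (\<l> (\<delta> t z) - t) * ?I (\<l> (\<delta> t z)) \<partial>M) =
        ennreal (exp (-(D*t))) * (\<integral>\<^sup>+z. G (\<l> z - t) * ?I (\<l> z) \<partial>M)"
      by (rule nn_integral_dilation[of "\<lambda>z. G (\<l> z - t) * ?I (\<l> z)" t]) measurable
  qed
  also have "\<dots> = (\<integral>\<^sup>+t. (\<integral>\<^sup>+z. ennreal (exp (-(D*t))) * (G (\<l> z - t) * ?I (\<l> z)) \<partial>M) \<partial>lborel)"
    by (intro nn_integral_cong nn_integral_cmult[symmetric]) measurable
  also have "\<dots> = (\<integral>\<^sup>+z. (\<integral>\<^sup>+t. ennreal (exp (-(D*t))) * (G (\<l> z - t) * ?I (\<l> z)) \<partial>lborel) \<partial>M)"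
    by (rule Fubini') measurable
  also have "\<dots> = (\<integral>\<^sup>+z. (?I (\<l> z) * ennreal (exp (-(D * \<l> z)))) * (\<integral>\<^sup>+s. G s * ennreal (exp (D * s)) \<partial>lborel) \<partial>M)"
  proof (intro nn_integral_cong)
    fix z
    have "(\<integral>\<^sup>+t. ennreal (exp (-(D*t))) * (G (\<l> z - t) * ?I (\<l> z)) \<partial>lborel)
        = (\<integral>\<^sup>+s. ennreal (exp (-(D*(\<l> z - s)))) * (G s * ?I (\<l> z)) \<partial>lborel)"
      by (subst nn_integral_real_affine[where c="-1" and t="\<l> z"]) auto
    also have "\<dots> = (\<integral>\<^sup>+s. (?I (\<l> z) * ennreal (exp (-(D * \<l> z)))) * (G s * ennreal (exp (D * s))) \<partial>lborel)"
    proof (intro nn_integral_cong)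
      fix s
      have "ennreal (exp (-(D*(\<l> z - s)))) = ennreal (exp (-(D * \<l> z))) * ennreal (exp (D * s))"
        by (simp add: ennreal_mult[symmetric] exp_add[symmetric] algebra_simps)
      then show "ennreal (exp (-(D*(\<l> z - s)))) * (G s * ?I (\<l> z)) =
          (?I (\<l> z) * ennreal (exp (-(D * \<l> z)))) * (G s * ennreal (exp (D * s)))"
        by (simp add: mult_ac)
    qed
    also have "\<dots> = (?I (\<l> z) * ennreal (exp (-(D * \<l> z)))) * (\<integral>\<^sup>+s. G s * ennreal (exp (D * s)) \<partial>lborel)"
      by (rule nn_integral_cmult) measurable
    finally show "(\<integral>\<^sup>+t. ennreal (exp (-(D*t))) * (G (\<l> z - t) * ?I (\<l> z)) \<partial>lborel) = \<dots>" .
  qed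
  also have "\<dots> = (\<integral>\<^sup>+z. ?I (\<l> z) * ennreal (exp (-(D * \<l> z))) \<partial>M) * (\<integral>\<^sup>+s. G s * ennreal (exp (D * s)) \<partial>lborel)"
    by (rule nn_integral_multc) measurable
  finally show ?thesis .
qed

end

lemma nn_integral_exp_Ici:
  assumes "a > 0" shows "(\<integral>\<^sup>+s. ennreal (exp (-(a * s))) * indicator {0..} s \<partial>lborel) = ennreal (1/a)"
proof -
  have "(\<integral>\<^sup>+s. ennreal (exp (-(a * s))) * indicator {0..} s \<partial>lborel) = ennreal (0 - (- exp (-(a*0)) / a))"
  proof (rule nn_integral_FTC_atLeast)
    show "((\<lambda>s. - exp (-(a * s)) / a) has_real_derivative exp (-(a * s))) (at s)" for s
      using assms by (auto intro!: derivative_eq_intros simp: field_simps)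
    show "((\<lambda>s. - exp (-(a * s)) / a) \<longlongrightarrow> 0) at_top"
      using assms by real_asymp
  qed auto
  then show ?thesis by simp
qed

text \<open>
  The function \<open>-e\<^bsup>as\<^esup> |\<phi>|\<^sup>2\<close> has derivative \<open>-e\<^bsup>as\<^esup> (a |\<phi>|\<^sup>2 + 2 \<phi> \<bullet> \<phi>')\<close>, which is at most \<open>e\<^bsup>as\<^esup> |\<phi>'|\<^sup>2 / a\<close>
  because \<open>|a \<phi> + \<phi>'|\<^sup>2 \<ge> 0\<close>; integrate from \<open>0\<close> to a zero of \<open>\<phi>\<close>. The growing factor \<open>e\<^bsup>as\<^esup>\<close> is affordable when the
  scaling of the measure contributes \<open>e\<^bsup>-Ds\<^esup>\<close> with \<open>D > a\<close>.
\<close>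

lemma sq_norm_le_half_line_integral:
  fixes \<phi> \<phi>' :: "real \<Rightarrow> 'b::real_inner"
  assumes "a > 0" and der: "\<And>s. s \<ge> 0 \<Longrightarrow> (\<phi> has_vector_derivative \<phi>' s) (at s)"
    and cont: "continuous_on {0..} \<phi>'" and S: "S \<ge> 0" "\<phi> S = 0"
  shows "ennreal ((norm (\<phi> 0))\<^sup>2) \<le>
    ennreal (1/a) * (\<integral>\<^sup>+s. ennreal (exp (a * s) * (norm (\<phi>' s))\<^sup>2) * indicator {0..} s \<partial>lborel)"
proof -
  define G where "G s = - exp (a * s) * (\<phi> s \<bullet> \<phi> s)" for s
  define g where "g s = - exp (a * s) * (a * (\<phi> s \<bullet> \<phi> s) + 2 * (\<phi> s \<bullet> \<phi>' s))" for s
  define h where "h s = (1/a) * (exp (a * s) * (norm (\<phi>' s))\<^sup>2)" for s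
  have "(G has_vector_derivative g s) (at s within {0..S})" if "s \<in> {0..S}" for s
  proof -
    have "(\<phi> has_derivative (\<lambda>x. x *\<^sub>R \<phi>' s)) (at s)"
      using der[of s] that by (simp add: has_vector_derivative_def)
    then have "(G has_derivative (\<lambda>x. x *\<^sub>R g s)) (at s)"
      unfolding G_def g_def
      by (auto intro!: derivative_eq_intros simp: fun_eq_iff inner_commute algebra_simps)
    then show ?thesis
      by (simp add: has_vector_derivative_def has_derivative_at_withinI)
  qed
  from fundamental_theorem_of_calculus[OF S(1) this]
  have I: "(g has_integral (G S - G 0)) {0..S}" .
  have ch: "continuous_on {0..S} h"
    unfolding h_def using cont
    by (intro continuous_intros) (auto intro: continuous_on_subset)
  then have H: "(h has_integral integral {0..S} h) {0..S}"
    by (intro integrable_integral integrable_continuous_real)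
  have le: "g s \<le> h s" for s
  proof -
    have "0 \<le> (norm (a *\<^sub>R \<phi> s + \<phi>' s))\<^sup>2" by simp
    also have "\<dots> = a\<^sup>2 * (\<phi> s \<bullet> \<phi> s) + 2 * a * (\<phi> s \<bullet> \<phi>' s) + (norm (\<phi>' s))\<^sup>2"
      unfolding power2_norm_eq_inner
      by (simp add: inner_add_left inner_add_right inner_commute power2_eq_square algebra_simps)
    finally have "- (a * (a * (\<phi> s \<bullet> \<phi> s) + 2 * (\<phi> s \<bullet> \<phi>' s))) \<le> (norm (\<phi>' s))\<^sup>2"
      by (simp add: power2_eq_square algebra_simps)
    then have "- (a * (\<phi> s \<bullet> \<phi> s) + 2 * (\<phi> s \<bullet> \<phi>' s)) \<le> (norm (\<phi>' s))\<^sup>2 / a"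
      using \<open>a > 0\<close> by (simp add: field_simps)
    from mult_left_mono[OF this, of "exp (a * s)"] show ?thesis
      by (simp add: g_def h_def algebra_simps)
  qed
  have "(norm (\<phi> 0))\<^sup>2 = G S - G 0" using S by (simp add: G_def power2_norm_eq_inner)
  also have "\<dots> \<le> integral {0..S} h" by (rule has_integral_le[OF I H le])
  finally have "ennreal ((norm (\<phi> 0))\<^sup>2) \<le> ennreal (integral {0..S} h)" by (rule ennreal_leI)
  also have "\<dots> = (\<integral>\<^sup>+s. ennreal (h s) * indicator {0..S} s \<partial>lborel)"
    using \<open>a > 0\<close> by (intro nn_integral_has_integral_lebesgue'[OF _ H, symmetric]) (simp add: h_def)
  also have "\<dots> \<le> (\<integral>\<^sup>+s. ennreal (1/a) * (ennreal (exp (a * s) * (norm (\<phi>' s))\<^sup>2) * indicator {0..} s) \<partial>lborel)"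
    using \<open>a > 0\<close> by (intro nn_integral_mono) (auto simp: h_def indicator_def ennreal_mult[symmetric])
  also have "\<dots> = ennreal (1/a) * (\<integral>\<^sup>+s. ennreal (exp (a * s) * (norm (\<phi>' s))\<^sup>2) * indicator {0..} s \<partial>lborel)"
  proof (rule nn_integral_cmult)
    have "(\<lambda>s. indicator {0..} s *\<^sub>R (exp (a * s) * (norm (\<phi>' s))\<^sup>2)) \<in> borel_measurable borel"
      using cont by (intro borel_measurable_continuous_on_indicator continuous_intros) auto
    then have "(\<lambda>s. ennreal (indicator {0..} s *\<^sub>R (exp (a * s) * (norm (\<phi>' s))\<^sup>2))) \<in> borel_measurable borel"
      by measurable
    also have "(\<lambda>s. ennreal (indicator {0..} s *\<^sub>R (exp (a * s) * (norm (\<phi>' s))\<^sup>2)))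
      = (\<lambda>s. ennreal (exp (a * s) * (norm (\<phi>' s))\<^sup>2) * indicator {0..} s)"
      by (auto simp: fun_eq_iff indicator_def)
    finally show "\<dots> \<in> borel_measurable lborel" by simp
  qed
  finally show ?thesis .
qed

text \<open>
  Hardy's inequality along the orbits, where \<open>h\<close> is the derivative of \<open>f\<close> in the direction of the flow. The
  orbitwise bound with exponent \<open>a\<close> produces the constant \<open>1 / (a (D - a))\<close> after Tonelli and rescaling; it is
  smallest for \<open>a = D/2\<close>.
\<close>

lemma (in dilation_measure) nn_integral_hardy:
  fixes f h :: "'a \<Rightarrow> 'b::real_inner"
  assumes "D > 0" and [measurable]: "h \<in> borel_measurable M"
    and der: "AE z in M. \<forall>s\<ge>0. ((\<lambda>s. f (\<delta> s z)) has_vector_derivative h (\<delta> s z)) (at s)"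
    and cont: "AE z in M. continuous_on {0..} (\<lambda>s. h (\<delta> s z))"
    and vanish: "AE z in M. \<exists>S\<ge>0. f (\<delta> S z) = 0"
    and \<delta>0: "\<And>z. \<delta> 0 z = z"
  shows "ennreal ((D/2)\<^sup>2) * (\<integral>\<^sup>+z. ennreal ((norm (f z))\<^sup>2) \<partial>M) \<le> (\<integral>\<^sup>+z. ennreal ((norm (h z))\<^sup>2) \<partial>M)"
proof -
  interpret pair_sigma_finite M "lborel :: real measure"
    by (intro pair_sigma_finite.intro sigma_finite_measure_axioms sigma_finite_lborel)
  define a where "a = D/2"
  have a: "a > 0" using \<open>D > 0\<close> by (simp add: a_def)
  let ?k = "\<lambda>s z. ennreal (exp (a * s) * (norm (h (\<delta> s z)))\<^sup>2) * indicator {0..} s"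
  let ?H = "\<integral>\<^sup>+z. ennreal ((norm (h z))\<^sup>2) \<partial>M"
  have "(\<integral>\<^sup>+z. ennreal ((norm (f z))\<^sup>2) \<partial>M) \<le> (\<integral>\<^sup>+z. ennreal (1/a) * (\<integral>\<^sup>+s. ?k s z \<partial>lborel) \<partial>M)"
  proof (rule nn_integral_mono_AE)
    show "AE z in M. ennreal ((norm (f z))\<^sup>2) \<le> ennreal (1/a) * (\<integral>\<^sup>+s. ?k s z \<partial>lborel)"
      using der cont vanish
    proof eventually_elim
      case (elim z)
      then obtain S where "S \<ge> 0" "f (\<delta> S z) = 0" by blast
      then show ?case
        using sq_norm_le_half_line_integral[of a "\<lambda>s. f (\<delta> s z)" "\<lambda>s. h (\<delta> s z)" S] a elim
        by (simp add: \<delta>0)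
    qed
  qed
  also have "\<dots> = ennreal (1/a) * (\<integral>\<^sup>+z. (\<integral>\<^sup>+s. ?k s z \<partial>lborel) \<partial>M)"
    by (rule nn_integral_cmult) measurable
  also have "(\<integral>\<^sup>+z. (\<integral>\<^sup>+s. ?k s z \<partial>lborel) \<partial>M) = (\<integral>\<^sup>+s. (\<integral>\<^sup>+z. ?k s z \<partial>M) \<partial>lborel)"
    by (rule Fubini'[symmetric]) measurable
  also have "\<dots> = (\<integral>\<^sup>+s. (ennreal (exp (-(a * s))) * indicator {0..} s) * ?H \<partial>lborel)"
  proof (intro nn_integral_cong)
    fix s
    have "(\<integral>\<^sup>+z. ?k s z \<partial>M) = (\<integral>\<^sup>+z. (ennreal (exp (a * s)) * indicator {0..} s) * ennreal ((norm (h (\<delta> s z)))\<^sup>2) \<partial>M)"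
      by (intro nn_integral_cong) (simp add: ennreal_mult' mult_ac)
    also have "\<dots> = (ennreal (exp (a * s)) * indicator {0..} s) * (\<integral>\<^sup>+z. ennreal ((norm (h (\<delta> s z)))\<^sup>2) \<partial>M)"
      by (rule nn_integral_cmult) measurable
    also have "(\<integral>\<^sup>+z. ennreal ((norm (h (\<delta> s z)))\<^sup>2) \<partial>M) = ennreal (exp (-(D * s))) * ?H"
      by (rule nn_integral_dilation[of "\<lambda>z. ennreal ((norm (h z))\<^sup>2)" s]) measurable
    also have "(ennreal (exp (a * s)) * indicator {0..} s) * (ennreal (exp (-(D * s))) * ?H)
        = ((ennreal (exp (a * s)) * ennreal (exp (-(D * s)))) * indicator {0..} s) * ?H"
      by (simp add: mult_ac)
    also have "ennreal (exp (a * s)) * ennreal (exp (-(D * s))) = ennreal (exp (-(a * s)))"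
      by (simp add: ennreal_mult[symmetric] exp_add[symmetric] a_def algebra_simps)
    finally show "(\<integral>\<^sup>+z. ?k s z \<partial>M) = (ennreal (exp (-(a * s))) * indicator {0..} s) * ?H" .
  qed
  also have "\<dots> = ennreal (1/a) * ?H"
    by (subst nn_integral_multc) (simp_all add: nn_integral_exp_Ici[OF a])
  finally have "ennreal (a\<^sup>2) * (\<integral>\<^sup>+z. ennreal ((norm (f z))\<^sup>2) \<partial>M) \<le> ennreal (a\<^sup>2) * (ennreal (1/a) * (ennreal (1/a) * ?H))"
    by (rule mult_left_mono) simp
  also have "\<dots> = (ennreal (a\<^sup>2) * ennreal (1/a) * ennreal (1/a)) * ?H" by (simp add: mult_ac)
  also have "ennreal (a\<^sup>2) * ennreal (1/a) * ennreal (1/a) = 1"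
    using a by (simp add: ennreal_mult[symmetric] power2_eq_square)
  finally show ?thesis by (simp add: a_def)
qed

lemma nn_integral_exp_Iic:
  assumes "a > 0"
  shows "(\<integral>\<^sup>+s. indicator {..b} s * ennreal (exp (a * s)) \<partial>lborel) = ennreal (exp (a * b) / a)"
proof -
  have "(\<integral>\<^sup>+s. indicator {..b} s * ennreal (exp (a * s)) \<partial>lborel)
      = (\<integral>\<^sup>+r. indicator {..b} (b - r) * ennreal (exp (a * (b - r))) \<partial>lborel)"
    by (subst nn_integral_real_affine[where c="-1" and t=b]) auto
  also have "\<dots> = (\<integral>\<^sup>+r. ennreal (exp (a * b)) * (ennreal (exp (-(a * r))) * indicator {0..} r) \<partial>lborel)"
    by (intro nn_integral_cong)
       (auto simp: indicator_def ennreal_mult[symmetric] exp_add[symmetric] algebra_simps)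
  also have "\<dots> = ennreal (exp (a * b)) * ennreal (1/a)"
    by (subst nn_integral_cmult) (simp_all add: nn_integral_exp_Ici[OF assms])
  finally show ?thesis using assms by (simp add: ennreal_mult[symmetric])
qed

text \<open>
  By the polar formula the mass below level \<open>b\<close> is the mass of the sphere times
  \<open>\<integral>\<^bsub>-\<infinity>\<^esub>\<^bsup>b\<^esup> e\<^bsup>Ds\<^esup> ds\<close>, so for \<open>D > 0\<close> local finiteness at the fixed point of the dilations follows from
  finiteness on one shell.
\<close>

lemma (in dilation_measure) emeasure_sublevel_finite:
  fixes \<l> :: "'a \<Rightarrow> real"
  assumes [measurable]: "\<l> \<in> borel_measurable M"
    and \<l>: "\<And>t. AE z in M. \<l> (\<delta> t z) = \<l> z + t"
    and "D > 0" and shell: "emeasure M {z \<in> space M. \<l> z \<in> {0..1}} < \<infinity>"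
  shows "emeasure M {z \<in> space M. \<l> z \<le> b} < \<infinity>"
proof -
  have "(\<integral>\<^sup>+z. indicator {0..1} (\<l> z) * ennreal (exp (-(D * \<l> z))) \<partial>M)
      \<le> (\<integral>\<^sup>+z. indicator {z \<in> space M. \<l> z \<in> {0..1}} z \<partial>M)"
    using \<open>D > 0\<close> by (intro nn_integral_mono) (auto simp: indicator_def intro!: ennreal_le_1[THEN iffD2])
  also have "\<dots> < \<infinity>" using shell by simp
  finally have c: "(\<integral>\<^sup>+z. indicator {0..1} (\<l> z) * ennreal (exp (-(D * \<l> z))) \<partial>M) < \<infinity>" .
  have "emeasure M {z \<in> space M. \<l> z \<le> b} = (\<integral>\<^sup>+z. indicator {z \<in> space M. \<l> z \<le> b} z \<partial>M)"
    by simp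
  also have "\<dots> = (\<integral>\<^sup>+z. indicator {..b} (\<l> z) \<partial>M)"
    by (intro nn_integral_cong) (auto simp: indicator_def)
  also have "\<dots> = (\<integral>\<^sup>+z. indicator {0..1} (\<l> z) * ennreal (exp (-(D * \<l> z))) \<partial>M) * ennreal (exp (D * b) / D)"
    by (subst nn_integral_polar[OF _ _ \<l>]) (simp_all add: nn_integral_exp_Iic[OF \<open>D > 0\<close>])
  also have "\<dots> < \<infinity>" using c by (simp add: ennreal_mult_less_top)
  finally show ?thesis .
qed

lemma (in dilation_measure) density_homogeneous:
  fixes w :: "'a \<Rightarrow> real"
  assumes [measurable]: "w \<in> borel_measurable M"
    and hom: "\<And>t. AE z in M. w (\<delta> t z) = exp (d * t) * w z"
  shows "dilation_measure (density M (\<lambda>z. ennreal (w z))) \<delta> (D + d)"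
proof -
  have "sigma_finite_measure (density M (\<lambda>z. ennreal (w z)))"
    by (subst sigma_finite_iff_density_finite) auto
  then interpret W: sigma_finite_measure "density M (\<lambda>z. ennreal (w z))" .
  show ?thesis
  proof unfold_locales
    show "case_prod \<delta> \<in> borel \<Otimes>\<^sub>M density M (\<lambda>z. ennreal (w z)) \<rightarrow>\<^sub>M density M (\<lambda>z. ennreal (w z))"
      using measurable_dilation by (simp cong: measurable_cong_sets sets_pair_measure_cong)
    fix F :: "'a \<Rightarrow> ennreal" and t
    assume "F \<in> borel_measurable (density M (\<lambda>z. ennreal (w z)))"
    then have [measurable]: "F \<in> borel_measurable M" by simp
    have "(\<integral>\<^sup>+z. F (\<delta> t z) \<partial>density M (\<lambda>z. ennreal (w z))) = (\<integral>\<^sup>+z. ennreal (w z) * F (\<delta> t z) \<partial>M)"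
      by (rule nn_integral_density) measurable
    also have "\<dots> = (\<integral>\<^sup>+z. ennreal (exp (-(d * t))) * (ennreal (w (\<delta> t z)) * F (\<delta> t z)) \<partial>M)"
    proof (rule nn_integral_cong_AE)
      show "AE z in M. ennreal (w z) * F (\<delta> t z) = ennreal (exp (-(d * t))) * (ennreal (w (\<delta> t z)) * F (\<delta> t z))"
        using hom[of t]
      proof eventually_elim
        case (elim z)
        have "ennreal (exp (-(d * t))) * ennreal (w (\<delta> t z)) = ennreal (w z)"
          by (simp add: elim ennreal_mult'[symmetric] mult.assoc[symmetric] exp_minus)
        then show ?case by (simp add: mult.assoc[symmetric])
      qed
    qed
    also have "\<dots> = ennreal (exp (-(d * t))) * (\<integral>\<^sup>+z. ennreal (w (\<delta> t z)) * F (\<delta> t z) \<partial>M)"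
      by (rule nn_integral_cmult) measurable
    also have "(\<integral>\<^sup>+z. ennreal (w (\<delta> t z)) * F (\<delta> t z) \<partial>M)
        = ennreal (exp (-(D * t))) * (\<integral>\<^sup>+z. ennreal (w z) * F z \<partial>M)"
      by (rule nn_integral_dilation[of "\<lambda>z. ennreal (w z) * F z" t]) measurable
    also have "(\<integral>\<^sup>+z. ennreal (w z) * F z \<partial>M) = (\<integral>\<^sup>+z. F z \<partial>density M (\<lambda>z. ennreal (w z)))"
      by (rule nn_integral_density[symmetric]) measurable
    finally have "(\<integral>\<^sup>+z. F (\<delta> t z) \<partial>density M (\<lambda>z. ennreal (w z)))
        = ennreal (exp (-(d * t))) * (ennreal (exp (-(D * t))) * (\<integral>\<^sup>+z. F z \<partial>density M (\<lambda>z. ennreal (w z))))" .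
    moreover have "exp (-((D + d) * t)) = exp (-(d * t)) * exp (-(D * t))"
      by (simp add: exp_add[symmetric] algebra_simps)
    ultimately show "(\<integral>\<^sup>+z. F (\<delta> t z) \<partial>density M (\<lambda>z. ennreal (w z)))
        = ennreal (exp (-((D + d) * t))) * (\<integral>\<^sup>+z. F z \<partial>density M (\<lambda>z. ennreal (w z)))"
      by (simp add: ennreal_mult mult.assoc)
  qed
qed

lemma dilation_measure_scaleR:
  "dilation_measure (lborel :: 'a::euclidean_space measure) (\<lambda>t x. exp (c * t) *\<^sub>R x) (c * real DIM('a))"
proof unfold_locales
  show "(\<lambda>(t, x). exp (c * t) *\<^sub>R x) \<in> borel \<Otimes>\<^sub>M (lborel :: 'a measure) \<rightarrow>\<^sub>M lborel"
    by simp
  fix F :: "'a \<Rightarrow> ennreal" and t :: real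
  assume "F \<in> borel_measurable lborel"
  then have [measurable]: "F \<in> borel_measurable borel" by simp
  let ?e = "exp (c * t)"
  have "(\<integral>\<^sup>+x. F x \<partial>lborel) = (\<integral>\<^sup>+x. F x \<partial>density (distr lborel borel (\<lambda>x. 0 + ?e *\<^sub>R x)) (\<lambda>_. ennreal (\<bar>?e\<bar> ^ DIM('a))))"
    by (subst lborel_affine[of ?e 0]) auto
  also have "\<dots> = (\<integral>\<^sup>+x. ennreal (?e ^ DIM('a)) * F (?e *\<^sub>R x) \<partial>lborel)"
    by (subst nn_integral_density) (auto simp: nn_integral_distr)
  also have "\<dots> = ennreal (?e ^ DIM('a)) * (\<integral>\<^sup>+x. F (?e *\<^sub>R x) \<partial>lborel)"
    by (rule nn_integral_cmult) measurable
  also have "?e ^ DIM('a) = exp (c * DIM('a) * t)"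
    using exp_of_nat_mult[of "DIM('a)" "c * t"] by (simp add: mult_ac)
  finally show "(\<integral>\<^sup>+x. F (?e *\<^sub>R x) \<partial>lborel) = ennreal (exp (-(c * DIM('a) * t))) * (\<integral>\<^sup>+x. F x \<partial>lborel)"
    by (simp add: mult.assoc[symmetric] ennreal_mult[symmetric] exp_add[symmetric])
qed

lemma dilation_measure_pair:
  assumes "dilation_measure M \<delta> D" and "dilation_measure N \<delta>' D'"
  shows "dilation_measure (M \<Otimes>\<^sub>M N) (\<lambda>t z. (\<delta> t (fst z), \<delta>' t (snd z))) (D + D')"
proof -
  interpret M: dilation_measure M \<delta> D by fact
  interpret N: dilation_measure N \<delta>' D' by fact
  interpret pair_sigma_finite M N
    by (intro pair_sigma_finite.intro M.sigma_finite_measure_axioms N.sigma_finite_measure_axioms)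
  note [measurable] = M.measurable_dilation N.measurable_dilation
  show ?thesis
  proof unfold_locales
    show "(\<lambda>(t, z). (\<delta> t (fst z), \<delta>' t (snd z))) \<in> borel \<Otimes>\<^sub>M (M \<Otimes>\<^sub>M N) \<rightarrow>\<^sub>M M \<Otimes>\<^sub>M N"
      by measurable
    fix F :: "_ \<Rightarrow> ennreal" and t :: real
    assume [measurable]: "F \<in> borel_measurable (M \<Otimes>\<^sub>M N)"
    have "(\<integral>\<^sup>+z. F (\<delta> t (fst z), \<delta>' t (snd z)) \<partial>(M \<Otimes>\<^sub>M N))
        = (\<integral>\<^sup>+x. (\<integral>\<^sup>+y. F (\<delta> t x, \<delta>' t y) \<partial>N) \<partial>M)"
      using N.nn_integral_fst[of "\<lambda>z. F (\<delta> t (fst z), \<delta>' t (snd z))" M] by simp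
    also have "\<dots> = (\<integral>\<^sup>+x. ennreal (exp (-(D' * t))) * (\<integral>\<^sup>+y. F (\<delta> t x, y) \<partial>N) \<partial>M)"
    proof (intro nn_integral_cong)
      fix x assume [measurable]: "x \<in> space M"
      have [measurable]: "\<delta> t x \<in> space M"
        using measurable_space[OF M.measurable_dilation, of "(t, x)"] \<open>x \<in> space M\<close>
        by (simp add: space_pair_measure)
      show "(\<integral>\<^sup>+y. F (\<delta> t x, \<delta>' t y) \<partial>N) = ennreal (exp (-(D' * t))) * (\<integral>\<^sup>+y. F (\<delta> t x, y) \<partial>N)"
        by (rule N.nn_integral_dilation[of "\<lambda>y. F (\<delta> t x, y)" t]) measurable
    qed
    also have "\<dots> = ennreal (exp (-(D' * t))) * (\<integral>\<^sup>+x. (\<integral>\<^sup>+y. F (\<delta> t x, y) \<partial>N) \<partial>M)"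
      by (rule nn_integral_cmult) measurable
    also have "(\<integral>\<^sup>+x. (\<integral>\<^sup>+y. F (\<delta> t x, y) \<partial>N) \<partial>M) = ennreal (exp (-(D * t))) * (\<integral>\<^sup>+x. (\<integral>\<^sup>+y. F (x, y) \<partial>N) \<partial>M)"
      by (rule M.nn_integral_dilation[of "\<lambda>x. \<integral>\<^sup>+y. F (x, y) \<partial>N" t]) measurable
    also have "(\<integral>\<^sup>+x. (\<integral>\<^sup>+y. F (x, y) \<partial>N) \<partial>M) = integral\<^sup>N (M \<Otimes>\<^sub>M N) F"
      by (rule N.nn_integral_fst) measurable
    finally have "(\<integral>\<^sup>+z. F (\<delta> t (fst z), \<delta>' t (snd z)) \<partial>(M \<Otimes>\<^sub>M N))
        = ennreal (exp (-(D' * t))) * (ennreal (exp (-(D * t))) * integral\<^sup>N (M \<Otimes>\<^sub>M N) F)" .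
    moreover have "exp (-((D + D') * t)) = exp (-(D' * t)) * exp (-(D * t))"
      by (simp add: exp_add[symmetric] algebra_simps)
    ultimately show "(\<integral>\<^sup>+z. F (\<delta> t (fst z), \<delta>' t (snd z)) \<partial>(M \<Otimes>\<^sub>M N))
        = ennreal (exp (-((D + D') * t))) * integral\<^sup>N (M \<Otimes>\<^sub>M N) F"
      by (simp add: ennreal_mult mult.assoc)
  qed
qed

text \<open>
  Local integrability of \<open>|x|\<^sup>p\<close> for \<open>p > -n\<close>: the measure \<open>|x|\<^sup>p dx\<close> has homogeneous dimension \<open>n + p\<close>
  under the isotropic dilations, and on the shell \<open>1 \<le> |x| \<le> e\<close> the density is bounded.
\<close>

lemma nn_integral_norm_powr_cball_finite:
  fixes p :: real
  assumes "real DIM('a::euclidean_space) + p > 0"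
  shows "(\<integral>\<^sup>+x\<in>cball (0::'a) R. ennreal (norm x powr p) \<partial>lborel) < \<infinity>"
proof -
  interpret L: dilation_measure "lborel :: 'a measure" "\<lambda>t x. exp (1 * t) *\<^sub>R x" "1 * real DIM('a)"
    by (rule dilation_measure_scaleR)
  let ?M = "density lborel (\<lambda>x::'a. ennreal (norm x powr p))"
  interpret dilation_measure ?M "\<lambda>t x. exp (1 * t) *\<^sub>R x" "1 * real DIM('a) + p"
    by (rule L.density_homogeneous) (auto simp: powr_mult exp_powr_real mult_ac)
  have "emeasure ?M {x \<in> space ?M. ln (norm x) \<le> ln (max R 1)} < \<infinity>"
  proof (rule emeasure_sublevel_finite)
    show "AE x in ?M. ln (norm (exp (1 * t) *\<^sub>R x)) = ln (norm x) + t" for t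
      using AE_lborel_singleton[of "0::'a"] by (simp add: AE_density) (auto elim!: eventually_mono simp: ln_mult)
    have "emeasure ?M {x \<in> space ?M. ln (norm x) \<in> {0..1}}
        = (\<integral>\<^sup>+x. ennreal (norm x powr p) * indicator {x::'a. ln (norm x) \<in> {0..1}} x \<partial>lborel)"
      by (simp add: emeasure_density)
    also have "\<dots> \<le> (\<integral>\<^sup>+x. ennreal (exp \<bar>p\<bar>) * indicator (cball 0 (exp 1)) (x::'a) \<partial>lborel)"
    proof (rule nn_integral_mono)
      fix x :: 'a
      have "norm x powr p \<le> exp \<bar>p\<bar> \<and> norm x \<le> exp 1" if "x \<noteq> 0" "ln (norm x) \<in> {0..1}"
      proof
        have "p * ln (norm x) \<le> \<bar>p\<bar> * 1"
          using that by (intro mult_mono) auto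
        then show "norm x powr p \<le> exp \<bar>p\<bar>" using that by (simp add: powr_def)
        have "exp (ln (norm x)) \<le> exp 1" using that unfolding exp_le_cancel_iff by simp
        then show "norm x \<le> exp 1" using that by simp
      qed
      then show "ennreal (norm x powr p) * indicator {x. ln (norm x) \<in> {0..1}} x
          \<le> ennreal (exp \<bar>p\<bar>) * indicator (cball 0 (exp 1)) x"
        by (cases "x = 0") (auto simp: indicator_def ennreal_leI)
    qed
    also have "\<dots> < \<infinity>"
      using emeasure_bounded_finite[of "cball (0::'a) (exp 1)"]
      by (subst nn_integral_cmult) (auto simp: ennreal_mult_less_top intro!: borel_measurable_indicator)
    finally show "emeasure ?M {x \<in> space ?M. ln (norm x) \<in> {0..1}} < \<infinity>" .
  qed (use assms in simp_all)
  also have "emeasure ?M {x \<in> space ?M. ln (norm x) \<le> ln (max R 1)}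
      = (\<integral>\<^sup>+x. ennreal (norm x powr p) * indicator {x::'a. ln (norm x) \<le> ln (max R 1)} x \<partial>lborel)"
    by (simp add: emeasure_density)
  finally have fin: "(\<integral>\<^sup>+x. ennreal (norm x powr p) * indicator {x::'a. ln (norm x) \<le> ln (max R 1)} x \<partial>lborel) < \<infinity>" .
  have "(\<integral>\<^sup>+x\<in>cball (0::'a) R. ennreal (norm x powr p) \<partial>lborel)
      \<le> (\<integral>\<^sup>+x. ennreal (norm x powr p) * indicator {x::'a. ln (norm x) \<le> ln (max R 1)} x \<partial>lborel)"
  proof (rule nn_integral_mono)
    fix x :: 'a
    show "ennreal (norm x powr p) * indicator (cball 0 R) x
        \<le> ennreal (norm x powr p) * indicator {x. ln (norm x) \<le> ln (max R 1)} x"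
      by (cases "x = 0") (auto simp: indicator_def)
  qed
  then show ?thesis using fin by (rule le_less_trans)
qed

section \<open>The gauge, its dilations and homogeneous weights\<close>

text \<open>
  For \<open>\<epsilon> = 0\<close> this is \<open>\<rho>\<^bsup>2(1+\<gamma>)\<^esup>\<close>. For \<open>\<epsilon> \<noteq> 0\<close> it is smooth and positive on the whole space, as the base
  of the real power stays away from \<open>0\<close>.
\<close>

definition gauge_power :: "real \<Rightarrow> real \<Rightarrow> (real^'m) \<times> (real^'k) \<Rightarrow> real" where
  "gauge_power \<gamma> \<epsilon> z = ((norm (fst z))\<^sup>2 + \<epsilon>\<^sup>2) powr (1+\<gamma>) + (1+\<gamma>)\<^sup>2 * (norm (snd z))\<^sup>2"

text \<open>
  For \<open>\<epsilon> = 0\<close> this is \<open>ln \<rho>\<close> away from the origin. Dilations act on it there by translation, which is the form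
  needed for the polar formula.
\<close>

definition log_gauge :: "real \<Rightarrow> real \<Rightarrow> (real^'m) \<times> (real^'k) \<Rightarrow> real" where
  "log_gauge \<gamma> \<epsilon> z = ln (gauge_power \<gamma> \<epsilon> z) / (2 * (1+\<gamma>))"

definition dilate :: "real \<Rightarrow> real \<Rightarrow> (real^'m) \<times> (real^'k) \<Rightarrow> (real^'m) \<times> (real^'k)" where
  "dilate \<gamma> t z = (exp t *\<^sub>R fst z, exp ((1+\<gamma>) * t) *\<^sub>R snd z)"

definition gauge_weight :: "real \<Rightarrow> real \<Rightarrow> real \<Rightarrow> (real^'m) \<times> (real^'k) \<Rightarrow> real" where
  "gauge_weight \<gamma> a p z = exp (a * log_gauge \<gamma> 0 z) * norm (fst z) powr p"

lemma measurable_fst_borel [measurable]: "fst \<in> borel_measurable (borel :: ('a::topological_space \<times> 'b::topological_space) measure)"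
  by (intro borel_measurable_continuous_onI continuous_intros)

lemma measurable_snd_borel [measurable]: "snd \<in> borel_measurable (borel :: ('a::topological_space \<times> 'b::topological_space) measure)"
  by (intro borel_measurable_continuous_onI continuous_intros)

lemma measurable_gauge_power [measurable]: "gauge_power \<gamma> \<epsilon> \<in> borel_measurable borel"
  unfolding gauge_power_def[abs_def] by measurable

lemma measurable_log_gauge [measurable]: "log_gauge \<gamma> \<epsilon> \<in> borel_measurable borel"
  unfolding log_gauge_def[abs_def] by measurable

lemma measurable_weight [measurable]: "gauge_weight \<gamma> a p \<in> borel_measurable borel"
  unfolding gauge_weight_def[abs_def] by measurable

lemma weight_nonneg: "0 \<le> gauge_weight \<gamma> a p z"
  by (simp add: gauge_weight_def)

lemma gauge_power_pos: "\<gamma> \<ge> 0 \<Longrightarrow> z \<noteq> 0 \<or> \<epsilon> \<noteq> 0 \<Longrightarrow> gauge_power \<gamma> \<epsilon> z > 0"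
  unfolding gauge_power_def
  by (cases z) (auto simp: zero_prod_def intro: add_pos_nonneg add_nonneg_pos)

lemma gauge_power_pos_of_fst: "\<gamma> \<ge> 0 \<Longrightarrow> fst z \<noteq> 0 \<Longrightarrow> gauge_power \<gamma> \<epsilon> z > 0"
  by (rule gauge_power_pos) auto

lemma rho_eq_exp_log_gauge:
  assumes "\<gamma> \<ge> 0" "z \<noteq> 0" shows "rho \<gamma> z = exp (log_gauge \<gamma> 0 z)"
proof -
  have "norm (fst z) powr (2 * (1+\<gamma>)) = (norm (fst z))\<^sup>2 powr (1+\<gamma>)"
    using powr_powr[of "norm (fst z)" 2 "1+\<gamma>"] by (cases "fst z = 0") simp_all
  then have "rho \<gamma> z = gauge_power \<gamma> 0 z powr (1 / (2 * (1+\<gamma>)))"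
    by (simp add: rho_def gauge_power_def)
  then show ?thesis using gauge_power_pos[of \<gamma> z 0] assms by (simp add: powr_def log_gauge_def)
qed

lemma log_gauge_dilate:
  assumes "\<gamma> \<ge> 0" "z \<noteq> 0" shows "log_gauge \<gamma> 0 (dilate \<gamma> t z) = log_gauge \<gamma> 0 z + t"
proof -
  have "(exp t * norm (fst z))\<^sup>2 powr (1+\<gamma>) = exp (2 * (1+\<gamma>) * t) * (norm (fst z))\<^sup>2 powr (1+\<gamma>)"
    by (simp add: power_mult_distrib powr_mult exp_double[symmetric] exp_powr_real mult_ac)
  moreover have "(exp ((1+\<gamma>) * t))\<^sup>2 = exp (2 * (1+\<gamma>) * t)"
    by (simp add: exp_double[symmetric] mult_ac)
  ultimately have "gauge_power \<gamma> 0 (dilate \<gamma> t z) = exp (2 * (1+\<gamma>) * t) * gauge_power \<gamma> 0 z"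
    by (simp add: gauge_power_def dilate_def power_mult_distrib algebra_simps)
  then show ?thesis
    using gauge_power_pos[of \<gamma> z 0] assms by (simp add: log_gauge_def ln_mult field_simps)
qed

lemma norm_le_of_log_gauge_le:
  assumes "\<gamma> \<ge> 0" "z \<noteq> 0 \<or> \<epsilon> \<noteq> 0" "log_gauge \<gamma> \<epsilon> z \<le> b"
  shows "norm (fst z) \<le> exp b" "norm (snd z) \<le> exp ((1+\<gamma>) * b)"
proof -
  have p: "gauge_power \<gamma> \<epsilon> z > 0" using gauge_power_pos assms by blast
  have "ln (gauge_power \<gamma> \<epsilon> z) \<le> 2 * (1+\<gamma>) * b"
    using assms by (simp add: log_gauge_def field_simps)
  then have le: "gauge_power \<gamma> \<epsilon> z \<le> exp (2 * (1+\<gamma>) * b)"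
    using p by (metis exp_le_cancel_iff exp_ln)
  show "norm (fst z) \<le> exp b"
  proof (cases "fst z = 0")
    case False
    have "(norm (fst z))\<^sup>2 powr (1+\<gamma>) \<le> ((norm (fst z))\<^sup>2 + \<epsilon>\<^sup>2) powr (1+\<gamma>)"
      using assms(1) by (intro powr_mono2) auto
    also have "\<dots> \<le> gauge_power \<gamma> \<epsilon> z" by (simp add: gauge_power_def)
    finally have "(norm (fst z))\<^sup>2 powr (1+\<gamma>) \<le> exp (2 * (1+\<gamma>) * b)" using le by simp
    then have "(1+\<gamma>) * (2 * ln (norm (fst z))) \<le> (1+\<gamma>) * (2 * b)"
      using False by (simp add: powr_def ln_realpow algebra_simps)
    then have "ln (norm (fst z)) \<le> b" using assms(1) by simp
    then show ?thesis using False by (metis exp_le_cancel_iff exp_ln norm_eq_zero zero_less_norm_iff)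
  qed simp
  have "(norm (snd z))\<^sup>2 \<le> (1+\<gamma>)\<^sup>2 * (norm (snd z))\<^sup>2"
    using assms(1) by (simp add: mult_le_cancel_right1 one_le_power)
  also have "\<dots> \<le> gauge_power \<gamma> \<epsilon> z" by (simp add: gauge_power_def)
  also have "\<dots> \<le> (exp ((1+\<gamma>) * b))\<^sup>2" using le by (simp add: exp_double[symmetric] mult_ac)
  finally show "norm (snd z) \<le> exp ((1+\<gamma>) * b)"
    by (rule power2_le_imp_le) simp
qed

text \<open>
  The weight \<open>\<rho>\<^sup>a |x|\<^sup>p\<close> is homogeneous of degree \<open>a + p\<close>. Both weights of the theorem have this form.
\<close>

lemma dilation_measure_weight:
  assumes "\<gamma> \<ge> 0"
  shows "dilation_measure (density lborel (\<lambda>z::(real^'m) \<times> (real^'k). ennreal (gauge_weight \<gamma> a p z))) (dilate \<gamma>)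
    (real CARD('m) + (1+\<gamma>) * real CARD('k) + (a + p))"
proof -
  have "dilation_measure (lborel \<Otimes>\<^sub>M lborel) (\<lambda>t z :: (real^'m) \<times> (real^'k). (exp (1 * t) *\<^sub>R fst z, exp ((1+\<gamma>) * t) *\<^sub>R snd z))
      (1 * real DIM(real^'m) + (1+\<gamma>) * real DIM(real^'k))"
    using dilation_measure_pair[OF dilation_measure_scaleR[where 'a="real^'m", of 1]
        dilation_measure_scaleR[where 'a="real^'k", of "1+\<gamma>"]] .
  then interpret L: dilation_measure "lborel :: ((real^'m) \<times> (real^'k)) measure" "dilate \<gamma>"
      "real CARD('m) + (1+\<gamma>) * real CARD('k)"
    by (simp add: lborel_prod dilate_def[abs_def])
  show ?thesis
  proof (rule L.density_homogeneous)
    fix t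
    show "AE z in lborel. gauge_weight \<gamma> a p (dilate \<gamma> t z) = exp ((a + p) * t) * gauge_weight \<gamma> a p (z::(real^'m) \<times> (real^'k))"
      using AE_lborel_singleton[of "0::(real^'m) \<times> (real^'k)"]
    proof eventually_elim
      case (elim z)
      have "norm (fst (dilate \<gamma> t z)) powr p = exp (p * t) * norm (fst z) powr p"
        by (simp add: dilate_def powr_mult exp_powr_real mult_ac)
      then show ?case
        using log_gauge_dilate[OF assms elim, of t] by (simp add: gauge_weight_def exp_add algebra_simps)
    qed
  qed simp
qed

lemma AE_fst_nonzero: "AE z in lborel. fst (z :: (real^'m) \<times> (real^'k)) \<noteq> 0"
proof -
  obtain i :: 'm where True by simp
  have "(axis i 1, 0) \<in> (Basis :: ((real^'m) \<times> (real^'k)) set)"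
    by (auto simp: Basis_prod_def axis_in_Basis_iff)
  from AE_lborel_inner_neq[OF this, of 0] show ?thesis
    by (rule eventually_mono) auto
qed

text \<open>
  On the shell \<open>1 \<le> \<rho> \<le> e\<close> the weight is comparable with \<open>|x|\<^sup>p\<close>, which is locally integrable because
  \<open>m + p > 0\<close>; the remaining part near the origin is controlled by homogeneity.
\<close>

lemma nn_integral_weight_sublevel_finite:
  assumes \<gamma>: "\<gamma> \<ge> 0" and p: "real CARD('m) + p > 0" and D: "real CARD('m) + (1+\<gamma>) * real CARD('k) + (a + p) > 0"
  shows "(\<integral>\<^sup>+z. ennreal (gauge_weight \<gamma> a p z) * indicator {z. log_gauge \<gamma> 0 z \<le> b} (z::(real^'m) \<times> (real^'k)) \<partial>lborel) < \<infinity>"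
proof -
  let ?M = "density lborel (\<lambda>z::(real^'m) \<times> (real^'k). ennreal (gauge_weight \<gamma> a p z))"
  interpret dilation_measure ?M "dilate \<gamma>" "real CARD('m) + (1+\<gamma>) * real CARD('k) + (a + p)"
    by (rule dilation_measure_weight[OF \<gamma>])
  let ?X = "cball (0::real^'m) (exp 1)" and ?Y = "cball (0::real^'k) (exp (1+\<gamma>))"
  have [measurable]: "?X \<in> sets borel" "?Y \<in> sets borel" by simp_all
  have "emeasure ?M {z \<in> space ?M. log_gauge \<gamma> 0 z \<le> b} < \<infinity>"
  proof (rule emeasure_sublevel_finite)
    show "AE z in ?M. log_gauge \<gamma> 0 (dilate \<gamma> t z) = log_gauge \<gamma> 0 z + t" for t
      using AE_lborel_singleton[of "0::(real^'m) \<times> (real^'k)"]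
      by (simp add: AE_density) (auto elim!: eventually_mono simp: log_gauge_dilate[OF \<gamma>])
    have "emeasure ?M {z \<in> space ?M. log_gauge \<gamma> 0 z \<in> {0..1}}
        = (\<integral>\<^sup>+z. ennreal (gauge_weight \<gamma> a p z) * indicator {z::(real^'m) \<times> (real^'k). log_gauge \<gamma> 0 z \<in> {0..1}} z \<partial>lborel)"
      by (simp add: emeasure_density)
    also have "\<dots> \<le> (\<integral>\<^sup>+z. ennreal (exp \<bar>a\<bar>) * ((ennreal (norm (fst z) powr p) * indicator ?X (fst z)) * indicator ?Y (snd z))
        \<partial>(lborel::((real^'m) \<times> (real^'k)) measure))"
    proof (rule nn_integral_mono)
      fix z :: "(real^'m) \<times> (real^'k)"
      show "ennreal (gauge_weight \<gamma> a p z) * indicator {z. log_gauge \<gamma> 0 z \<in> {0..1}} z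
        \<le> ennreal (exp \<bar>a\<bar>) * ((ennreal (norm (fst z) powr p) * indicator ?X (fst z)) * indicator ?Y (snd z))"
      proof (cases "fst z \<noteq> 0 \<and> log_gauge \<gamma> 0 z \<in> {0..1}")
        case True
        then have "z \<noteq> 0" by auto
        with True have "norm (fst z) \<le> exp 1" "norm (snd z) \<le> exp (1+\<gamma>)"
          using norm_le_of_log_gauge_le[OF \<gamma>, of z 0 1] by auto
        moreover have "a * log_gauge \<gamma> 0 z \<le> \<bar>a\<bar> * 1"
          using True by (intro mult_mono) auto
        then have "gauge_weight \<gamma> a p z \<le> exp \<bar>a\<bar> * norm (fst z) powr p"
          by (simp add: gauge_weight_def mult_right_mono)
        ultimately show ?thesis
          using True by (simp add: ennreal_mult[symmetric] ennreal_leI)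
      qed (auto simp: gauge_weight_def)
    qed
    also have "\<dots> = ennreal (exp \<bar>a\<bar>) * (\<integral>\<^sup>+z. ((ennreal (norm (fst z) powr p) * indicator ?X (fst z)) * indicator ?Y (snd z))
        \<partial>(lborel::((real^'m) \<times> (real^'k)) measure))"
      by (rule nn_integral_cmult) (simp add: borel_prod[symmetric])
    also have "(\<integral>\<^sup>+z. ((ennreal (norm (fst z) powr p) * indicator ?X (fst z)) * indicator ?Y (snd z)) \<partial>(lborel::((real^'m) \<times> (real^'k)) measure))
        = (\<integral>\<^sup>+x. (\<integral>\<^sup>+y. (ennreal (norm x powr p) * indicator ?X x) * indicator ?Y y \<partial>lborel) \<partial>lborel)"
      by (subst lborel_prod[symmetric], subst lborel.nn_integral_fst[symmetric]) simp_all
    also have "\<dots> = (\<integral>\<^sup>+x. ennreal (norm x powr p) * indicator ?X x \<partial>lborel) * emeasure lborel ?Y"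
      by (simp add: nn_integral_cmult nn_integral_multc)
    also have "ennreal (exp \<bar>a\<bar>) * \<dots> < \<infinity>"
      using nn_integral_norm_powr_cball_finite[where 'a="real^'m", of p "exp 1"] p
        emeasure_bounded_finite[of ?Y]
      by (simp add: ennreal_mult_less_top)
    finally show "emeasure ?M {z \<in> space ?M. log_gauge \<gamma> 0 z \<in> {0..1}} < \<infinity>" .
  qed (use D in simp_all)
  then show ?thesis by (simp add: emeasure_density)
qed

section \<open>Derivatives of the gauge and the Hardy inequality\<close>

lemma has_derivative_log_gauge:
  fixes z :: "(real^'m) \<times> (real^'k)"
  assumes \<gamma>: "\<gamma> \<ge> 0" and z: "fst z \<noteq> 0 \<or> \<epsilon> \<noteq> 0"
  shows "(log_gauge \<gamma> \<epsilon> has_derivative (\<lambda>v. (((norm (fst z))\<^sup>2 + \<epsilon>\<^sup>2) powr \<gamma> * (fst z \<bullet> fst v) + (1+\<gamma>) * (snd z \<bullet> snd v))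
    / gauge_power \<gamma> \<epsilon> z)) (at z)"
proof -
  have A: "(norm (fst z))\<^sup>2 + \<epsilon>\<^sup>2 > 0"
    using z by (auto intro: add_pos_nonneg add_nonneg_pos)
  have P: "gauge_power \<gamma> \<epsilon> z > 0" using gauge_power_pos[OF \<gamma>, of z \<epsilon>] z by auto
  let ?A = "\<lambda>z::(real^'m) \<times> (real^'k). (fst z \<bullet> fst z) + \<epsilon>\<^sup>2"
  have dA: "(?A has_derivative (\<lambda>v. 2 * (fst z \<bullet> fst v))) (at z)"
    by (auto intro!: derivative_eq_intros simp: inner_commute)
  have powr_der: "((\<lambda>t. t powr (1+\<gamma>)) has_derivative (\<lambda>h. h * ((1+\<gamma>) * (?A z) powr \<gamma>))) (at (?A z))"
    using has_real_derivative_powr[of "?A z" "1+\<gamma>"] A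
    by (simp add: has_field_derivative_def mult_commute_abs power2_norm_eq_inner)
  have dPowr: "((\<lambda>z. ?A z powr (1+\<gamma>)) has_derivative (\<lambda>v. 2 * (fst z \<bullet> fst v) * ((1+\<gamma>) * ?A z powr \<gamma>))) (at z)"
    by (rule has_derivative_compose[OF dA powr_der])
  have dB: "((\<lambda>z::(real^'m) \<times> (real^'k). (1+\<gamma>)\<^sup>2 * (snd z \<bullet> snd z)) has_derivative (\<lambda>v. (1+\<gamma>)\<^sup>2 * (2 * (snd z \<bullet> snd v)))) (at z)"
    by (auto intro!: derivative_eq_intros simp: inner_commute)
  have gauge_power_eq: "gauge_power \<gamma> \<epsilon> = (\<lambda>z. ?A z powr (1+\<gamma>) + (1+\<gamma>)\<^sup>2 * (snd z \<bullet> snd z))"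
    by (simp add: gauge_power_def fun_eq_iff power2_norm_eq_inner)
  have dP: "(gauge_power \<gamma> \<epsilon> has_derivative (\<lambda>v. 2 * (fst z \<bullet> fst v) * ((1+\<gamma>) * ?A z powr \<gamma>) + (1+\<gamma>)\<^sup>2 * (2 * (snd z \<bullet> snd v)))) (at z)"
    unfolding gauge_power_eq by (rule has_derivative_add[OF dPowr dB])
  have ln_der: "(ln has_derivative (\<lambda>h. h * (1 / gauge_power \<gamma> \<epsilon> z))) (at (gauge_power \<gamma> \<epsilon> z))"
    by (rule has_derivative_eq_rhs[OF DERIV_ln_divide[OF P, unfolded has_field_derivative_def]])
       (simp add: fun_eq_iff)
  have "((\<lambda>z. ln (gauge_power \<gamma> \<epsilon> z)) has_derivative
      (\<lambda>v. (2 * (fst z \<bullet> fst v) * ((1+\<gamma>) * ?A z powr \<gamma>) + (1+\<gamma>)\<^sup>2 * (2 * (snd z \<bullet> snd v))) * (1 / gauge_power \<gamma> \<epsilon> z))) (at z)"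
    by (rule has_derivative_compose[OF dP ln_der])
  then have "((\<lambda>z. (1 / (2 * (1+\<gamma>))) * ln (gauge_power \<gamma> \<epsilon> z)) has_derivative
      (\<lambda>v. (1 / (2 * (1+\<gamma>))) * ((2 * (fst z \<bullet> fst v) * ((1+\<gamma>) * ?A z powr \<gamma>) + (1+\<gamma>)\<^sup>2 * (2 * (snd z \<bullet> snd v))) * (1 / gauge_power \<gamma> \<epsilon> z)))) (at z)"
    by (rule has_derivative_mult_right)
  also have "(\<lambda>v. (1 / (2 * (1+\<gamma>))) * ((2 * (fst z \<bullet> fst v) * ((1+\<gamma>) * ?A z powr \<gamma>) + (1+\<gamma>)\<^sup>2 * (2 * (snd z \<bullet> snd v))) * (1 / gauge_power \<gamma> \<epsilon> z)))
    = (\<lambda>v. (((norm (fst z))\<^sup>2 + \<epsilon>\<^sup>2) powr \<gamma> * (fst z \<bullet> fst v) + (1+\<gamma>) * (snd z \<bullet> snd v)) / gauge_power \<gamma> \<epsilon> z)"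
  proof
    fix v
    have "(1 / (2 * g)) * ((2 * a * (g * A) + g\<^sup>2 * (2 * b)) * (1 / p)) = (A * a + g * b) / p"
      if "g > 0" "p > 0" for a A b g p :: real
      using that by (simp add: field_simps power2_eq_square)
    from this[of "1+\<gamma>" "gauge_power \<gamma> \<epsilon> z" "fst z \<bullet> fst v" "?A z powr \<gamma>" "snd z \<bullet> snd v"]
    show "(1 / (2 * (1+\<gamma>))) * ((2 * (fst z \<bullet> fst v) * ((1+\<gamma>) * ?A z powr \<gamma>) + (1+\<gamma>)\<^sup>2 * (2 * (snd z \<bullet> snd v))) * (1 / gauge_power \<gamma> \<epsilon> z))
      = (((norm (fst z))\<^sup>2 + \<epsilon>\<^sup>2) powr \<gamma> * (fst z \<bullet> fst v) + (1+\<gamma>) * (snd z \<bullet> snd v)) / gauge_power \<gamma> \<epsilon> z"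
      using \<gamma> P by (simp add: power2_norm_eq_inner)
  qed
  finally show ?thesis by (simp add: log_gauge_def[abs_def])
qed

lemma grad_x_eq: "(f has_derivative f') (at z) \<Longrightarrow> grad_x f z = (\<chi> i. f' (axis i 1, 0))"
  and grad_y_eq: "(f has_derivative f') (at z) \<Longrightarrow> grad_y f z = (\<chi> j. f' (0, axis j 1))"
  by (simp_all add: grad_x_def grad_y_def flip: frechet_derivative_at)

lemma gauge_power_eq_exp_log_gauge:
  assumes "\<gamma> \<ge> 0" "z \<noteq> 0 \<or> \<epsilon> \<noteq> 0" shows "gauge_power \<gamma> \<epsilon> z = exp (2 * (1+\<gamma>) * log_gauge \<gamma> \<epsilon> z)"
  using gauge_power_pos[OF assms] assms by (simp add: log_gauge_def)

lemma gauge_power_zero_eq: "fst z \<noteq> 0 \<Longrightarrow>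
    gauge_power \<gamma> 0 z = (norm (fst z) powr \<gamma>)\<^sup>2 * (norm (fst z))\<^sup>2 + ((1+\<gamma>) * norm (snd z))\<^sup>2"
  by (simp add: gauge_power_def powr_add powr_mult power2_eq_square)

text \<open>
  This is \<open>|\<nabla>\<^sub>\<gamma>\<rho>| = |x|\<^sup>\<gamma> / \<rho>\<^sup>\<gamma>\<close>, away from the set \<open>x = 0\<close>.
\<close>

lemma norm_grushin_grad_rho:
  fixes z :: "(real^'m) \<times> (real^'k)"
  assumes \<gamma>: "\<gamma> \<ge> 0" and z: "fst z \<noteq> 0"
  shows "norm (grushin_grad \<gamma> (rho \<gamma>) z) = norm (fst z) powr \<gamma> * exp (-(\<gamma> * log_gauge \<gamma> 0 z))"
proof -
  let ?l = "log_gauge \<gamma> 0 z" and ?P = "gauge_power \<gamma> 0 z" and ?X = "norm (fst z) powr \<gamma>"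
  have z0: "z \<noteq> 0" using z by auto
  have P: "?P > 0" using gauge_power_pos[OF \<gamma>, of z 0] z0 by auto
  have sq: "((norm (fst z))\<^sup>2) powr \<gamma> = ?X\<^sup>2" using z by (simp add: power2_eq_square powr_mult)
  have "((\<lambda>z. exp (log_gauge \<gamma> 0 z)) has_derivative
      (\<lambda>v. ((?X\<^sup>2 * (fst z \<bullet> fst v) + (1+\<gamma>) * (snd z \<bullet> snd v)) / ?P) * exp ?l)) (at z)"
    using has_derivative_exp[OF has_derivative_log_gauge[OF \<gamma>, of z 0]] z by (simp add: sq)
  then have "(rho \<gamma> has_derivative
      (\<lambda>v. ((?X\<^sup>2 * (fst z \<bullet> fst v) + (1+\<gamma>) * (snd z \<bullet> snd v)) / ?P) * exp ?l)) (at z)"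
    by (rule has_derivative_transform_within_open[where s="- {0}"])
       (simp_all add: z0 rho_eq_exp_log_gauge[OF \<gamma>] open_Compl)
  note grad_x_eq[OF this] grad_y_eq[OF this]
  then have gx: "grad_x (rho \<gamma>) z = (?X\<^sup>2 * exp ?l / ?P) *\<^sub>R fst z"
    and gy: "grad_y (rho \<gamma>) z = ((1+\<gamma>) * exp ?l / ?P) *\<^sub>R snd z"
    by (simp_all add: vec_eq_iff inner_axis)
  have "(norm (grushin_grad \<gamma> (rho \<gamma>) z))\<^sup>2 = (?X\<^sup>2 * exp ?l / ?P * norm (fst z))\<^sup>2 + (?X * ((1+\<gamma>) * exp ?l / ?P * norm (snd z)))\<^sup>2"
    using P \<gamma> by (simp add: grushin_grad_def norm_Pair gx gy abs_mult)
  also have "\<dots> = (?X * exp ?l / ?P)\<^sup>2 * ?P"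
  proof -
    have "(X\<^sup>2 * E / P * x)\<^sup>2 + (X * (g * E / P * y))\<^sup>2 = (X * E / P)\<^sup>2 * (X\<^sup>2 * x\<^sup>2 + (g * y)\<^sup>2)" for X E P x g y :: real
      by (simp add: divide_inverse power2_eq_square algebra_simps)
    then show ?thesis by (simp only: gauge_power_zero_eq[OF z, of \<gamma>])
  qed
  also have "\<dots> = (?X * exp ?l)\<^sup>2 / ?P" using P by (simp add: power2_eq_square)
  also have "\<dots> = (?X * exp (-(\<gamma> * ?l)))\<^sup>2"
  proof -
    have "(exp ?l)\<^sup>2 / ?P = (exp (-(\<gamma> * ?l)))\<^sup>2"
      using gauge_power_eq_exp_log_gauge[OF \<gamma>, of z 0] z0
      by (simp add: exp_double[symmetric] exp_diff[symmetric] algebra_simps)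
    then show ?thesis by (simp add: power_mult_distrib times_divide_eq_right[symmetric] del: times_divide_eq_right)
  qed
  finally show ?thesis by (rule power2_eq_imp_eq) auto
qed

lemma hardy_weight_eq:
  assumes \<gamma>: "\<gamma> \<ge> 0" and z: "fst z \<noteq> 0"
  shows "hardy_weight \<gamma> \<alpha>1 \<alpha>2 z = gauge_weight \<gamma> (\<alpha>1 - \<gamma> * \<alpha>2) (\<gamma> * \<alpha>2) z"
proof -
  have "z \<noteq> 0" using z by auto
  then show ?thesis
    unfolding hardy_weight_def norm_grushin_grad_rho[OF \<gamma> z] rho_eq_exp_log_gauge[OF \<gamma> \<open>z \<noteq> 0\<close>] gauge_weight_def
    using exp_add[of "log_gauge \<gamma> 0 z * \<alpha>1" "-(\<gamma> * log_gauge \<gamma> 0 z) * \<alpha>2"]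
    by (simp add: powr_mult powr_powr exp_powr_real algebra_simps)
qed

text \<open>
  The factor is \<open>|\<nabla>\<^sub>\<gamma>\<rho>|\<^sup>2 / \<rho>\<^sup>2 = |x|\<^bsup>2\<gamma>\<^esup> / \<rho>\<^bsup>2(1+\<gamma>)\<^esup>\<close>, which relates the weight of the energy to that of
  the mass.
\<close>

lemma weight_shift:
  assumes \<gamma>: "\<gamma> \<ge> 0" and z: "fst z \<noteq> 0"
  shows "gauge_weight \<gamma> a p z * (norm (fst z) powr \<gamma>)\<^sup>2 / gauge_power \<gamma> 0 z = gauge_weight \<gamma> (a - 2 * (1+\<gamma>)) (p + 2 * \<gamma>) z"
proof -
  have z0: "z \<noteq> 0" using z by auto
  have "norm (fst z) powr (p + 2 * \<gamma>) = norm (fst z) powr p * (norm (fst z) powr \<gamma>)\<^sup>2"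
    using powr_add[of "norm (fst z)" \<gamma> \<gamma>] by (simp add: powr_add power2_eq_square)
  moreover have "exp ((a - 2 * (1+\<gamma>)) * log_gauge \<gamma> 0 z) = exp (a * log_gauge \<gamma> 0 z) / gauge_power \<gamma> 0 z"
    using gauge_power_eq_exp_log_gauge[OF \<gamma>, of z 0] z0 by (simp add: exp_diff[symmetric] algebra_simps)
  ultimately show ?thesis by (simp add: gauge_weight_def)
qed

lemma hardy_mass_weight_eq:
  assumes \<gamma>: "\<gamma> \<ge> 0" and z: "fst z \<noteq> 0"
  shows "hardy_weight \<gamma> \<alpha>1 \<alpha>2 z * ((norm (grushin_grad \<gamma> (rho \<gamma>) z))\<^sup>2 / (rho \<gamma> z)\<^sup>2)
    = gauge_weight \<gamma> (\<alpha>1 - \<gamma> * \<alpha>2 - 2 * (1+\<gamma>)) (\<gamma> * \<alpha>2 + 2 * \<gamma>) z"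
proof -
  have z0: "z \<noteq> 0" using z by auto
  have e: "(exp (-(\<gamma> * log_gauge \<gamma> 0 z)))\<^sup>2 * exp (2 * (1+\<gamma>) * log_gauge \<gamma> 0 z) = (exp (log_gauge \<gamma> 0 z))\<^sup>2"
    unfolding exp_double[symmetric] exp_add[symmetric] by (simp add: algebra_simps)
  have "(norm (grushin_grad \<gamma> (rho \<gamma>) z))\<^sup>2 / (rho \<gamma> z)\<^sup>2 = (norm (fst z) powr \<gamma>)\<^sup>2 / gauge_power \<gamma> 0 z"
    unfolding norm_grushin_grad_rho[OF \<gamma> z] rho_eq_exp_log_gauge[OF \<gamma> z0] gauge_power_eq_exp_log_gauge[OF \<gamma> disjI1[OF z0]]
    using e by (simp add: power_mult_distrib field_simps)
  then show ?thesis using weight_shift[OF assms] by (simp add: hardy_weight_eq[OF assms])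
qed

lemma linear_axis_sum_fst:
  fixes L :: "(real^'m) \<times> (real^'k) \<Rightarrow> 'b::real_vector"
  assumes "linear L" shows "L (x, 0) = (\<Sum>i\<in>UNIV. x $ i *\<^sub>R L (axis i 1, 0))"
proof -
  interpret L: linear L by fact
  have "(x, 0) = (\<Sum>i\<in>UNIV. x $ i *\<^sub>R (axis i 1, 0 :: real^'k))"
    by (simp add: prod_eq_iff fst_sum snd_sum basis_expansion[of x, unfolded scalar_mult_eq_scaleR])
  then show ?thesis by (simp only: L.sum L.scaleR)
qed

lemma linear_axis_sum_snd:
  fixes L :: "(real^'m) \<times> (real^'k) \<Rightarrow> 'b::real_vector"
  assumes "linear L" shows "L (0, y) = (\<Sum>j\<in>UNIV. y $ j *\<^sub>R L (0, axis j 1))"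
proof -
  interpret L: linear L by fact
  have "(0, y) = (\<Sum>j\<in>UNIV. y $ j *\<^sub>R (0 :: real^'m, axis j 1))"
    by (simp add: prod_eq_iff fst_sum snd_sum basis_expansion[of y, unfolded scalar_mult_eq_scaleR])
  then show ?thesis by (simp only: L.sum L.scaleR)
qed

lemma radial_deriv_x_eq:
  assumes "(f has_derivative f') (at z)"
  shows "radial_deriv_x f z = f' (fst z /\<^sub>R norm (fst z), 0)"
  using linear_axis_sum_fst[OF has_derivative_linear[OF assms], of "fst z /\<^sub>R norm (fst z)"]
  by (simp add: radial_deriv_x_def grad_x_eq[OF assms])

text \<open>
  The generator of the dilations splits as \<open>Z = |x| d/d|x| + (1+\<gamma>) y \<cdot> \<nabla>\<^sub>y\<close>. Its first part only sees the radial
  derivative in \<open>x\<close>, so the theorem holds with this derivative in place of the full gradient in \<open>x\<close>.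
\<close>

lemma norm_euler_derivative_le:
  assumes "(f has_derivative f') (at z)" and \<gamma>: "\<gamma> \<ge> 0" and z: "fst z \<noteq> 0"
  shows "norm (f' (fst z, (1+\<gamma>) *\<^sub>R snd z))
    \<le> norm (fst z) * norm (radial_deriv_x f z) + (1+\<gamma>) * norm (snd z) * norm (grad_y f z)"
proof -
  interpret linear f' using assms(1) by (rule has_derivative_linear)
  have "(fst z, (1+\<gamma>) *\<^sub>R snd z) = norm (fst z) *\<^sub>R (fst z /\<^sub>R norm (fst z), 0) + (1+\<gamma>) *\<^sub>R (0, snd z)"
    using z by simp
  then have "f' (fst z, (1+\<gamma>) *\<^sub>R snd z) = norm (fst z) *\<^sub>R radial_deriv_x f z + (1+\<gamma>) *\<^sub>R f' (0, snd z)"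
    unfolding radial_deriv_x_eq[OF assms(1)] by (simp only: add scaleR)
  then have "norm (f' (fst z, (1+\<gamma>) *\<^sub>R snd z)) \<le> norm (fst z) * norm (radial_deriv_x f z) + (1+\<gamma>) * norm (f' (0, snd z))"
    using norm_triangle_ineq[of "norm (fst z) *\<^sub>R radial_deriv_x f z" "(1+\<gamma>) *\<^sub>R f' (0, snd z)"] \<gamma> by simp
  moreover have "norm (f' (0, snd z)) \<le> norm (snd z) * norm (grad_y f z)"
  proof -
    have "norm (f' (0, snd z)) \<le> (\<Sum>j\<in>UNIV. norm (snd z $ j *\<^sub>R grad_y f z $ j))"
      unfolding linear_axis_sum_snd[OF has_derivative_linear[OF assms(1)], of "snd z"]
      by (simp add: grad_y_eq[OF assms(1)] sum_norm_le)
    also have "\<dots> = (\<Sum>j\<in>UNIV. \<bar>norm (snd z $ j)\<bar> * \<bar>norm (grad_y f z $ j)\<bar>)" by simp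
    also have "\<dots> \<le> norm (snd z) * norm (grad_y f z)"
      unfolding norm_vec_def by (rule L2_set_mult_ineq)
    finally show ?thesis .
  qed
  ultimately show ?thesis using \<gamma>
    by (smt (verit) mult.assoc mult_left_mono)
qed

text \<open>
  Cauchy-Schwarz for the pairs \<open>(|x|\<^bsup>1+\<gamma>\<^esup>, (1+\<gamma>)|y|)\<close> and \<open>(|df/d|x||, |x|\<^sup>\<gamma> |\<nabla>\<^sub>y f|)\<close>: the first has
  squared norm \<open>\<rho>\<^bsup>2(1+\<gamma>)\<^esup>\<close>, the second is the energy density, and \<open>|x|\<^sup>\<gamma> |Z f|\<close> is bounded by their product.
\<close>

lemma energy_density_ge:
  assumes "(f has_derivative f') (at z)" and \<gamma>: "\<gamma> \<ge> 0" and z: "fst z \<noteq> 0"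
  shows "gauge_weight \<gamma> (a - 2 * (1+\<gamma>)) (p + 2 * \<gamma>) z * (norm (f' (fst z, (1+\<gamma>) *\<^sub>R snd z)))\<^sup>2
    \<le> gauge_weight \<gamma> a p z * ((norm (radial_deriv_x f z))\<^sup>2 + norm (fst z) powr (2 * \<gamma>) * (norm (grad_y f z))\<^sup>2)"
proof -
  let ?X = "norm (fst z) powr \<gamma>" and ?x = "norm (fst z)" and ?y = "(1+\<gamma>) * norm (snd z)"
    and ?r = "norm (radial_deriv_x f z)" and ?g = "norm (grad_y f z)"
  have z0: "z \<noteq> 0" using z by auto
  have P: "gauge_power \<gamma> 0 z > 0" using gauge_power_pos[OF \<gamma>, of z 0] z0 by auto
  have "?X\<^sup>2 * (norm (f' (fst z, (1+\<gamma>) *\<^sub>R snd z)))\<^sup>2 \<le> ?X\<^sup>2 * (?x * ?r + ?y * ?g)\<^sup>2"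
    using norm_euler_derivative_le[OF assms] by (intro mult_left_mono power_mono) auto
  \<comment> \<open>The added square is the defect in Lagrange's identity, which proves Cauchy-Schwarz.\<close>
  also have "\<dots> \<le> ?X\<^sup>2 * (?x * ?r + ?y * ?g)\<^sup>2 + (?x * ?X\<^sup>2 * ?g - ?y * ?r)\<^sup>2" by simp
  also have "\<dots> = gauge_power \<gamma> 0 z * (?r\<^sup>2 + ?X\<^sup>2 * ?g\<^sup>2)"
    unfolding gauge_power_zero_eq[OF z, of \<gamma>] by (simp add: power2_eq_square algebra_simps)
  finally have "?X\<^sup>2 / gauge_power \<gamma> 0 z * (norm (f' (fst z, (1+\<gamma>) *\<^sub>R snd z)))\<^sup>2 \<le> ?r\<^sup>2 + ?X\<^sup>2 * ?g\<^sup>2"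
    using P by (simp add: field_simps)
  from mult_left_mono[OF this weight_nonneg[of \<gamma> a p z]]
  have "gauge_weight \<gamma> a p z * ?X\<^sup>2 / gauge_power \<gamma> 0 z * (norm (f' (fst z, (1+\<gamma>) *\<^sub>R snd z)))\<^sup>2 \<le> gauge_weight \<gamma> a p z * (?r\<^sup>2 + ?X\<^sup>2 * ?g\<^sup>2)"
    by (simp add: mult.assoc)
  moreover have "?X\<^sup>2 = ?x powr (2 * \<gamma>)"
    by (simp add: power2_eq_square flip: powr_add mult_2)
  ultimately show ?thesis unfolding weight_shift[OF \<gamma> z] by simp
qed

lemma has_vector_derivative_along_dilate:
  fixes f :: "(real^'m) \<times> (real^'k) \<Rightarrow> 'b::real_normed_vector"
  assumes "(f has_derivative f') (at (dilate \<gamma> s z))"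
  shows "((\<lambda>s. f (dilate \<gamma> s z)) has_vector_derivative f' (fst (dilate \<gamma> s z), (1+\<gamma>) *\<^sub>R snd (dilate \<gamma> s z))) (at s)"
proof -
  have "((\<lambda>s. dilate \<gamma> s z) has_vector_derivative (fst (dilate \<gamma> s z), (1+\<gamma>) *\<^sub>R snd (dilate \<gamma> s z))) (at s)"
    unfolding dilate_def fst_conv snd_conv
    by (intro has_vector_derivative_Pair) (auto intro!: derivative_eq_intros has_vector_derivative_scaleR[THEN has_vector_derivative_eq_rhs] simp: mult_ac)
  then show ?thesis
    using vector_derivative_diff_chain_within[of "\<lambda>s. dilate \<gamma> s z" _ s UNIV f f']
      has_derivative_at_withinI[OF assms] by (simp add: o_def)
qed

text \<open>
  For positive times every dilation expands at least by \<open>e\<^sup>t\<close>, hence moves each nonzero point out of the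
  support of a test function.
\<close>

lemma norm_dilate_ge:
  assumes "\<gamma> \<ge> 0" "t \<ge> 0" shows "norm (dilate \<gamma> t z) \<ge> exp t * norm z"
proof -
  have "exp t * norm z = norm (exp t *\<^sub>R z)" by simp
  also have "\<dots> = sqrt ((exp t * norm (fst z))\<^sup>2 + (exp t * norm (snd z))\<^sup>2)"
    by (simp add: norm_prod_def)
  also have "\<dots> \<le> sqrt ((exp t * norm (fst z))\<^sup>2 + (exp ((1+\<gamma>) * t) * norm (snd z))\<^sup>2)"
    using assms by (intro real_sqrt_le_mono add_left_mono power_mono mult_right_mono) (auto simp: algebra_simps)
  also have "\<dots> = norm (dilate \<gamma> t z)" by (simp add: norm_prod_def dilate_def)
  finally show ?thesis .
qed

text \<open>
  The hypothesis gives derivatives only away from the origin, but the function vanishes identically near it, so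
  it is continuously differentiable on the whole space. This supplies the measurability of the directional
  derivatives.
\<close>

lemma test_function_punctured_C1:
  fixes f :: "'a::euclidean_space \<Rightarrow> 'b::real_normed_vector"
  assumes f: "test_function_on (UNIV - {0}) f"
  shows "f differentiable (at z)" and "continuous_on UNIV (\<lambda>z. frechet_derivative f (at z) v)"
proof -
  let ?V = "- closure {z. f z \<noteq> 0}"
  have V: "open ?V" "0 \<in> ?V" using f by (auto simp: test_function_on_def)
  have zero: "(f has_derivative (\<lambda>v. 0)) (at z)" if "z \<in> ?V" for z
    by (rule has_derivative_transform_within_open[OF has_derivative_const[of 0] V(1) that])
       (use closure_subset[of "{z. f z \<noteq> 0}"] in auto)
  have C1: "Ck_on (Suc 0) (UNIV - {0}) f" using f unfolding test_function_on_def smooth_on_def by blast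
  show "f differentiable (at z)"
    using C1 zero[of z] V by (cases "z = 0") (auto simp: differentiable_def)
  have "continuous_on ((UNIV - {0}) \<union> ?V) (\<lambda>z. frechet_derivative f (at z) v)"
  proof (rule continuous_on_open_Un)
    show "continuous_on (UNIV - {0}) (\<lambda>z. frechet_derivative f (at z) v)" using C1 by simp
    show "continuous_on ?V (\<lambda>z. frechet_derivative f (at z) v)"
      by (rule continuous_on_eq[OF continuous_on_const[of _ 0]]) (simp flip: frechet_derivative_at[OF zero])
  qed (use V in auto)
  also have "(UNIV - {0}) \<union> ?V = UNIV" using V by auto
  finally show "continuous_on UNIV (\<lambda>z. frechet_derivative f (at z) v)" .
qed

lemma test_function_vanishes_along_dilate:
  assumes f: "test_function_on (UNIV - {0}) f" and "\<gamma> \<ge> 0" "z \<noteq> 0"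
  shows "\<exists>S\<ge>0. f (dilate \<gamma> S z) = 0"
proof -
  have "bounded {z. f z \<noteq> 0}"
    using f bounded_subset[OF compact_imp_bounded closure_subset] unfolding test_function_on_def by blast
  then obtain B where B: "\<And>z. f z \<noteq> 0 \<Longrightarrow> norm z \<le> B" "B > 0"
    by (auto simp: bounded_pos)
  \<comment> \<open>The crude bound \<open>e\<^sup>S > S\<close> suffices to leave the ball of radius \<open>B\<close>.\<close>
  define S where "S = B / norm z"
  have S: "S \<ge> 0" using B by (simp add: S_def)
  have "B = S * norm z" using \<open>z \<noteq> 0\<close> by (simp add: S_def)
  also have "\<dots> < exp S * norm z" using \<open>z \<noteq> 0\<close> by (intro mult_strict_right_mono exp_gt_self) auto
  also have "\<dots> \<le> norm (dilate \<gamma> S z)" by (rule norm_dilate_ge[OF assms(2) S])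
  finally have "f (dilate \<gamma> S z) = 0" using B(1)[of "dilate \<gamma> S z"] by (meson not_le)
  then show ?thesis using S by blast
qed

text \<open>
  Both sides are compared with integrals against the measure \<open>W dz\<close> of homogeneous dimension \<open>D\<close>: the mass is
  the integral of \<open>|f|\<^sup>2\<close>, and the energy is at least that of \<open>|Z f|\<^sup>2\<close>.
\<close>

theorem grushin_hardy_inequality:
  fixes f :: "(real^'m) \<times> (real^'k) \<Rightarrow> complex"
  assumes \<gamma>: "\<gamma> \<ge> 0" and D: "D = real CARD('m) + (1+\<gamma>) * real CARD('k) + \<alpha>1 - 2" "D > 0"
    and f: "test_function_on (UNIV - {0}) f"
  shows "ennreal ((D / 2)\<^sup>2) * hardy_mass \<gamma> \<alpha>1 \<alpha>2 f \<le> hardy_energy \<gamma> \<alpha>1 \<alpha>2 f"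
proof -
  let ?a = "\<alpha>1 - \<gamma> * \<alpha>2" and ?p = "\<gamma> * \<alpha>2"
  let ?w = "\<lambda>z::(real^'m) \<times> (real^'k). gauge_weight \<gamma> (?a - 2 * (1+\<gamma>)) (?p + 2 * \<gamma>) z"
  let ?M = "density lborel (\<lambda>z. ennreal (?w z))"
  have "D = real CARD('m) + (1+\<gamma>) * real CARD('k) + ((?a - 2 * (1+\<gamma>)) + (?p + 2 * \<gamma>))"
    by (simp add: D(1))
  then interpret dilation_measure ?M "dilate \<gamma>" D
    using dilation_measure_weight[OF \<gamma>, where 'm='m and 'k='k, of "?a - 2 * (1+\<gamma>)" "?p + 2 * \<gamma>"]
    by (simp only:)
  define h where "h z = frechet_derivative f (at z) (fst z, (1+\<gamma>) *\<^sub>R snd z)" for z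
  note diff = test_function_punctured_C1(1)[OF f] and cont = test_function_punctured_C1(2)[OF f]
  have der: "(f has_derivative frechet_derivative f (at z)) (at z)" for z
    using diff[of z] by (simp add: frechet_derivative_works)
  have f_cont: "continuous_on UNIV f"
    using diff by (simp add: continuous_at_imp_continuous_on differentiable_imp_continuous_within)
  have [measurable]: "f \<in> borel_measurable borel" using f_cont by (rule borel_measurable_continuous_onI)
  have h_cont: "continuous_on UNIV h"
  proof -
    have "h z = (\<Sum>b\<in>Basis. ((fst z, (1+\<gamma>) *\<^sub>R snd z) \<bullet> b) *\<^sub>R frechet_derivative f (at z) b)" for z
    proof -
      interpret linear "frechet_derivative f (at z)" using der by (rule has_derivative_linear)
      have "h z = frechet_derivative f (at z) (\<Sum>b\<in>Basis. ((fst z, (1+\<gamma>) *\<^sub>R snd z) \<bullet> b) *\<^sub>R b)"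
        by (simp only: h_def euclidean_representation)
      then show ?thesis by (simp only: sum scaleR)
    qed
    then have h: "h = (\<lambda>z. \<Sum>b\<in>Basis. ((fst z, (1+\<gamma>) *\<^sub>R snd z) \<bullet> b) *\<^sub>R frechet_derivative f (at z) b)" by (rule ext)
    show ?thesis unfolding h by (intro continuous_intros cont)
  qed
  then have [measurable]: "h \<in> borel_measurable borel" by (rule borel_measurable_continuous_onI)
  have "hardy_mass \<gamma> \<alpha>1 \<alpha>2 f = (\<integral>\<^sup>+z. ennreal (?w z) * ennreal ((norm (f z))\<^sup>2) \<partial>lborel)"
    unfolding hardy_mass_def
  proof (rule nn_integral_cong_AE)
    show "AE z in lborel. ennreal (hardy_weight \<gamma> \<alpha>1 \<alpha>2 z * ((norm (grushin_grad \<gamma> (rho \<gamma>) z))\<^sup>2 / (rho \<gamma> z)\<^sup>2) * (cmod (f z))\<^sup>2)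
      = ennreal (?w z) * ennreal ((norm (f z))\<^sup>2)"
      using AE_fst_nonzero
    proof eventually_elim
      case (elim z)
      show ?case unfolding hardy_mass_weight_eq[OF \<gamma> elim] by (simp add: ennreal_mult' weight_nonneg)
    qed
  qed
  also have "\<dots> = (\<integral>\<^sup>+z. ennreal ((norm (f z))\<^sup>2) \<partial>?M)"
    by (rule nn_integral_density[symmetric]) measurable
  finally have mass: "hardy_mass \<gamma> \<alpha>1 \<alpha>2 f = (\<integral>\<^sup>+z. ennreal ((norm (f z))\<^sup>2) \<partial>?M)" .
  have "ennreal ((D/2)\<^sup>2) * (\<integral>\<^sup>+z. ennreal ((norm (f z))\<^sup>2) \<partial>?M) \<le> (\<integral>\<^sup>+z. ennreal ((norm (h z))\<^sup>2) \<partial>?M)"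
  proof (rule nn_integral_hardy[OF D(2)])
    show "AE z in ?M. \<forall>s\<ge>0. ((\<lambda>s. f (dilate \<gamma> s z)) has_vector_derivative h (dilate \<gamma> s z)) (at s)"
      using has_vector_derivative_along_dilate[OF der] by (simp add: h_def)
    have "continuous_on UNIV (\<lambda>s. dilate \<gamma> s z)" for z :: "(real^'m) \<times> (real^'k)"
      unfolding dilate_def by (intro continuous_intros)
    then show "AE z in ?M. continuous_on {0..} (\<lambda>s. h (dilate \<gamma> s z))"
      by (intro AE_I2 continuous_on_subset[OF continuous_on_compose2[OF h_cont]]) auto
    show "AE z in ?M. \<exists>S\<ge>0. f (dilate \<gamma> S z) = 0"
      using AE_lborel_singleton[of "0::(real^'m) \<times> (real^'k)"] test_function_vanishes_along_dilate[OF f \<gamma>]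
      by (simp add: AE_density) (auto elim!: eventually_mono)
  qed (simp_all add: dilate_def)
  also have "\<dots> = (\<integral>\<^sup>+z. ennreal (?w z) * ennreal ((norm (h z))\<^sup>2) \<partial>lborel)"
    by (rule nn_integral_density) measurable
  also have "\<dots> \<le> hardy_energy \<gamma> \<alpha>1 \<alpha>2 f"
    unfolding hardy_energy_def
  proof (rule nn_integral_mono_AE)
    show "AE z in lborel. ennreal (?w z) * ennreal ((norm (h z))\<^sup>2) \<le> ennreal (hardy_weight \<gamma> \<alpha>1 \<alpha>2 z *
        ((cmod (radial_deriv_x f z))\<^sup>2 + norm (fst z) powr (2 * \<gamma>) * (norm (grad_y f z))\<^sup>2))"
      using AE_fst_nonzero
    proof eventually_elim
      case (elim z)
      then show ?case
        using energy_density_ge[OF der \<gamma> elim, of ?a ?p]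
        by (simp add: h_def hardy_weight_eq[OF \<gamma> elim] ennreal_mult'[symmetric] weight_nonneg ennreal_leI)
    qed
  qed
  finally show ?thesis by (simp add: mass)
qed

section \<open>Calculus of smooth functions on the whole space\<close>

lemma Ck_on_SucD: "Ck_on (Suc k) S f \<Longrightarrow> Ck_on k S f"
proof (induction k arbitrary: f)
  case 0
  then show ?case
    by (auto intro!: continuous_at_imp_continuous_on differentiable_imp_continuous_within)
next
  case (Suc k)
  then show ?case by simp
qed

lemma Ck_on_subset: "Ck_on k S f \<Longrightarrow> T \<subseteq> S \<Longrightarrow> Ck_on k T f"
  by (induction k arbitrary: f) (auto intro: continuous_on_subset)

lemma Ck_on_SucI:
  assumes "\<And>z. (f has_derivative f' z) (at z)" and "\<And>v. Ck_on k UNIV (\<lambda>z. f' z v)"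
  shows "Ck_on (Suc k) UNIV f"
proof -
  have "frechet_derivative f (at z) = f' z" for z
    using frechet_derivative_at[OF assms(1)] by simp
  then show ?thesis using assms by (auto simp: differentiable_def)
qed

lemma Ck_on_SucE:
  assumes "Ck_on (Suc k) UNIV f"
  obtains f' where "\<And>z. (f has_derivative f' z) (at z)" and "\<And>v. Ck_on k UNIV (\<lambda>z. f' z v)"
proof (rule that[of "\<lambda>z. frechet_derivative f (at z)"])
  show "(f has_derivative frechet_derivative f (at z)) (at z)" for z
    using assms by (simp flip: frechet_derivative_works)
qed (use assms in simp)

lemma Ck_on_const: "Ck_on k UNIV (\<lambda>z. c)"
proof (induction k arbitrary: c)
  case (Suc k)
  then show ?case by (intro Ck_on_SucI[where f'="\<lambda>z v. 0"]) auto
qed simp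

lemma Ck_on_add: "Ck_on k UNIV f \<Longrightarrow> Ck_on k UNIV g \<Longrightarrow> Ck_on k UNIV (\<lambda>z. f z + g z)"
proof (induction k arbitrary: f g)
  case (Suc k)
  obtain f' g' where "\<And>z. (f has_derivative f' z) (at z)" "\<And>v. Ck_on k UNIV (\<lambda>z. f' z v)"
    and "\<And>z. (g has_derivative g' z) (at z)" "\<And>v. Ck_on k UNIV (\<lambda>z. g' z v)"
    using Suc.prems by (metis Ck_on_SucE)
  then show ?case by (intro Ck_on_SucI[where f'="\<lambda>z v. f' z v + g' z v"] has_derivative_add Suc.IH)
qed (simp add: continuous_on_add)

lemma (in bounded_bilinear) Ck_on_prod:
  "Ck_on k UNIV f \<Longrightarrow> Ck_on k UNIV g \<Longrightarrow> Ck_on k UNIV (\<lambda>z. prod (f z) (g z))"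
proof (induction k arbitrary: f g)
  case (Suc k)
  obtain f' g' where f: "\<And>z. (f has_derivative f' z) (at z)" "\<And>v. Ck_on k UNIV (\<lambda>z. f' z v)"
    and g: "\<And>z. (g has_derivative g' z) (at z)" "\<And>v. Ck_on k UNIV (\<lambda>z. g' z v)"
    using Suc.prems by (metis Ck_on_SucE)
  show ?case
    using Suc.prems[THEN Ck_on_SucD] f g
    by (intro Ck_on_SucI[where f'="\<lambda>z v. prod (f z) (g' z v) + prod (f' z v) (g z)"] FDERIV Ck_on_add Suc.IH)
qed (simp add: continuous_on)

lemma Ck_on_bounded_linear:
  assumes "bounded_linear f" shows "Ck_on k UNIV f"
proof (cases k)
  case 0 then show ?thesis by (simp add: linear_continuous_on assms)
next
  case (Suc j)
  then show ?thesis
    using Ck_on_SucI[OF bounded_linear_imp_has_derivative[OF assms] Ck_on_const] by simp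
qed

text \<open>
  A family of functions that is closed under differentiation on \<open>T\<close> consists of smooth functions, and by the chain
  and product rules composition with it preserves the order of smoothness. Working with families avoids writing
  down higher derivatives: powers, the exponential and the flat functions below each lie in such a family.
\<close>

lemma Ck_on_compose_real:
  fixes \<F> :: "(real \<Rightarrow> real) set"
  assumes \<F>: "\<And>h. h \<in> \<F> \<Longrightarrow> \<exists>h'\<in>\<F>. \<forall>t\<in>T. (h has_real_derivative h' t) (at t)"
    and u: "\<And>z. u z \<in> T"
  shows "Ck_on k UNIV u \<Longrightarrow> h \<in> \<F> \<Longrightarrow> Ck_on k UNIV (\<lambda>z. h (u z))"
proof (induction k arbitrary: h)
  case 0
  have "continuous_on T h"
    using \<F>[OF 0(2)] by (metis DERIV_isCont continuous_at_imp_continuous_on)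
  then show ?case
    using 0(1) continuous_on_compose2[of T h UNIV u] u by auto
next
  case (Suc k)
  obtain h' where h': "h' \<in> \<F>" "\<And>t. t \<in> T \<Longrightarrow> (h has_derivative (*) (h' t)) (at t)"
    using \<F>[OF Suc.prems(2)] by (auto simp: has_field_derivative_def)
  obtain u' where u': "\<And>z. (u has_derivative u' z) (at z)" "\<And>v. Ck_on k UNIV (\<lambda>z. u' z v)"
    using Suc.prems(1) by (metis Ck_on_SucE)
  show ?case
  proof (rule Ck_on_SucI)
    show "((\<lambda>z. h (u z)) has_derivative (\<lambda>v. h' (u z) * u' z v)) (at z)" for z
      by (rule has_derivative_compose[OF u'(1) h'(2)[OF u]])
    show "Ck_on k UNIV (\<lambda>z. h' (u z) * u' z v)" for v
      using bounded_bilinear.Ck_on_prod[OF bounded_bilinear_mult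
        Suc.IH[OF Ck_on_SucD[OF Suc.prems(1)] h'(1)] u'(2)[of v]] .
  qed
qed

lemma Ck_on_powr:
  assumes "\<And>z. u z > 0" "Ck_on k UNIV u" shows "Ck_on k UNIV (\<lambda>z. u z powr (a::real))"
proof -
  have "Ck_on k UNIV (\<lambda>z. (\<lambda>t. 1 * t powr a) (u z))"
  proof (rule Ck_on_compose_real[where \<F>="{h. \<exists>c a. h = (\<lambda>t. c * t powr a)}" and T="{0<..}"
      and h="\<lambda>t. 1 * t powr a" and u=u])
    fix h :: "real \<Rightarrow> real" assume "h \<in> {h. \<exists>c a. h = (\<lambda>t. c * t powr a)}"
    then obtain c a where h: "h = (\<lambda>t. c * t powr a)" by blast
    show "\<exists>h'\<in>{h. \<exists>c a. h = (\<lambda>t. c * t powr a)}. \<forall>t\<in>{0<..}. (h has_real_derivative h' t) (at t)"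
    proof (rule bexI)
      show "\<forall>t\<in>{0<..}. (h has_real_derivative (c * a) * t powr (a - 1)) (at t)"
        unfolding h by (auto intro!: derivative_eq_intros)
    qed blast
  next
    show "u z \<in> {0<..}" for z using assms(1) by simp
    show "(\<lambda>t. 1 * t powr a) \<in> {h. \<exists>c a. h = (\<lambda>t. c * t powr a)}" by blast
  qed (rule assms(2))
  then show ?thesis by simp
qed

lemma Ck_on_ln:
  fixes u :: "_ \<Rightarrow> real"
  assumes "\<And>z. u z > 0" "\<And>k. Ck_on k UNIV u" shows "Ck_on k UNIV (\<lambda>z. ln (u z))"
proof (cases k)
  case 0
  then show ?thesis using assms(2)[of 0] assms(1) by (auto intro!: continuous_intros) (metis less_irrefl)
next
  case (Suc j)
  obtain u' where u': "\<And>z. (u has_derivative u' z) (at z)" "\<And>v. Ck_on j UNIV (\<lambda>z. u' z v)"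
    using assms(2) Ck_on_SucE by blast
  show ?thesis unfolding Suc
  proof (rule Ck_on_SucI)
    have "(ln has_derivative (\<lambda>h. h * u z powr (-1))) (at (u z))" for z
      by (rule has_derivative_eq_rhs[OF DERIV_ln_divide[OF assms(1), unfolded has_field_derivative_def]])
         (use assms(1)[of z] in \<open>simp add: fun_eq_iff powr_minus_divide\<close>)
    then show "((\<lambda>z. ln (u z)) has_derivative (\<lambda>v. u' z v * u z powr (-1))) (at z)" for z
      by (rule has_derivative_compose[OF u'(1)])
    show "Ck_on j UNIV (\<lambda>z. u' z v * u z powr (-1))" for v
      by (intro bounded_bilinear.Ck_on_prod[OF bounded_bilinear_mult] u' Ck_on_powr assms)
  qed
qed

lemma Ck_on_exp:
  fixes u :: "_ \<Rightarrow> real"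
  assumes "Ck_on k UNIV u" shows "Ck_on k UNIV (\<lambda>z. exp (u z))"
  by (rule Ck_on_compose_real[where \<F>="{exp}" and T=UNIV and h=exp]) (use assms in \<open>auto intro: DERIV_exp\<close>)

section \<open>A one-dimensional extremising family\<close>

text \<open>
  For \<open>p = 1\<close> this is the standard function \<open>e\<^bsup>-1/t\<^esup>\<close>, extended by zero, which is smooth and flat at \<open>0\<close>.
  Admitting a polynomial in \<open>1/t\<close> as a factor makes the family closed under differentiation.
\<close>

definition flat :: "real poly \<Rightarrow> real \<Rightarrow> real" where
  "flat p t = (if t > 0 then poly p (1/t) * exp (-(1/t)) else 0)"

lemma poly_mult_exp_minus_tendsto_0: "((\<lambda>x::real. poly p x * exp (-x)) \<longlongrightarrow> 0) at_top"
proof -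
  have "((\<lambda>x::real. \<Sum>i\<le>degree p. coeff p i * (x ^ i / exp x)) \<longlongrightarrow> 0) at_top"
    by (intro tendsto_null_sum tendsto_mult_right_zero tendsto_power_div_exp_0)
  then show ?thesis
    by (simp add: poly_altdef exp_minus sum_distrib_right divide_inverse mult.assoc)
qed

text \<open>
  At \<open>0\<close> the difference quotient is again of this form, with \<open>p(X)\<close> replaced by \<open>X p(X)\<close>, and tends to \<open>0\<close> since the
  exponential beats every polynomial.
\<close>

lemma flat_has_derivative:
  "(flat p has_real_derivative flat ([:0, 0, 1:] * (p - pderiv p)) t) (at t)"
proof -
  let ?q = "[:0, 0, 1:] * (p - pderiv p)"
  consider "t > 0" | "t < 0" | "t = 0" by linarith
  then show ?thesis
  proof cases
    case 1
    have "((\<lambda>t. poly p (1/t) * exp (-(1/t))) has_real_derivative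
        poly (pderiv p) (1/t) * (-(1/t\<^sup>2)) * exp (-(1/t)) + poly p (1/t) * (exp (-(1/t)) * (1/t\<^sup>2))) (at t)"
      using 1 by (auto intro!: derivative_eq_intros DERIV_chain'[OF _ poly_DERIV] simp: power2_eq_square field_simps)
    also have "poly (pderiv p) (1/t) * (-(1/t\<^sup>2)) * exp (-(1/t)) + poly p (1/t) * (exp (-(1/t)) * (1/t\<^sup>2)) = flat ?q t"
      using 1 by (simp add: flat_def power2_eq_square field_simps)
    finally show ?thesis
      by (rule has_field_derivative_transform_within_open[where S="{0<..}"]) (use 1 in \<open>auto simp: flat_def\<close>)
  next
    case 2
    have "((\<lambda>t. 0) has_real_derivative flat ?q t) (at t)" using 2 by (simp add: flat_def)
    then show ?thesis
      by (rule has_field_derivative_transform_within_open[where S="{..<0}"]) (use 2 in \<open>auto simp: flat_def\<close>)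
  next
    case 3
    \<comment> \<open>With \<open>x = 1/h\<close> the quotient is \<open>x p(x) e\<^bsup>-x\<^esup>\<close>.\<close>
    have "((\<lambda>h. flat p h / h) \<longlongrightarrow> 0) (at_right 0)"
    proof -
      have "((\<lambda>h::real. poly (pCons 0 p) (inverse h) * exp (- inverse h)) \<longlongrightarrow> 0) (at_right 0)"
        by (rule filterlim_compose[OF poly_mult_exp_minus_tendsto_0 filterlim_inverse_at_top_right])
      moreover have "eventually (\<lambda>h::real. poly (pCons 0 p) (inverse h) * exp (- inverse h) = flat p h / h) (at_right 0)"
        using eventually_at_right_less[of "0::real"]
        by eventually_elim (simp add: flat_def divide_inverse)
      ultimately show ?thesis by (rule Lim_transform_eventually)
    qed
    moreover have "((\<lambda>h. flat p h / h) \<longlongrightarrow> 0) (at_left 0)"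
    proof (rule Lim_transform_eventually[OF tendsto_const])
      show "eventually (\<lambda>h. 0 = flat p h / h) (at_left 0)"
        by (rule eventually_at_leftI[of "-1"]) (auto simp: flat_def)
    qed
    ultimately have "((\<lambda>h. flat p h / h) \<longlongrightarrow> 0) (at 0)" by (simp add: filterlim_at_split)
    then show ?thesis using 3 by (simp add: DERIV_def flat_def)
  qed
qed

lemma Ck_on_flat:
  assumes "Ck_on k UNIV u" shows "Ck_on k UNIV (\<lambda>z. flat p (u z))"
proof (rule Ck_on_compose_real[where \<F>="range flat" and T=UNIV and h="flat p"])
  fix h assume "h \<in> range flat"
  then show "\<exists>h'\<in>range flat. \<forall>t\<in>UNIV. (h has_real_derivative h' t) (at t)"
    using flat_has_derivative by auto
qed (use assms in auto)

definition bump :: "real \<Rightarrow> real" where "bump s = flat 1 (1 - s\<^sup>2)"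

definition bump' :: "real \<Rightarrow> real" where "bump' s = flat [:0, 0, 1:] (1 - s\<^sup>2) * (- 2 * s)"

lemma bump_has_derivative: "(bump has_real_derivative bump' s) (at s)"
  unfolding bump_def[abs_def] bump'_def
  by (rule DERIV_chain2[OF _ ])
     (use flat_has_derivative[of 1 "1 - s\<^sup>2"] in \<open>auto intro!: derivative_eq_intros\<close>)

lemma continuous_bump: "continuous_on S bump" "continuous_on S bump'"
proof -
  have flat: "continuous_on UNIV (flat p)" for p
    by (rule DERIV_continuous_on[where D="flat ([:0, 0, 1:] * (p - pderiv p))"])
       (rule has_field_derivative_at_within, rule flat_has_derivative)
  have "continuous_on S (\<lambda>s. flat p (1 - s\<^sup>2))" for p
    by (rule continuous_on_compose2[OF flat]) (auto intro!: continuous_intros)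
  then show "continuous_on S bump" "continuous_on S bump'"
    unfolding bump_def[abs_def] bump'_def[abs_def] by (simp_all add: continuous_on_mult continuous_on_mult_left continuous_on_minus)
qed

lemma bump_eq_0: "\<bar>s\<bar> \<ge> 1 \<Longrightarrow> bump s = 0" "\<bar>s\<bar> \<ge> 1 \<Longrightarrow> bump' s = 0"
proof -
  assume "\<bar>s\<bar> \<ge> 1" then have "1 \<le> s\<^sup>2" using power_mono[of 1 "\<bar>s\<bar>" 2] by simp
  then show "bump s = 0" "bump' s = 0" by (auto simp: bump_def bump'_def flat_def)
qed

lemma bump_ge:
  assumes "\<bar>s\<bar> \<le> 1/2" shows "bump s \<ge> exp (-2)"
proof -
  have "s\<^sup>2 \<le> (1/2)\<^sup>2" using power_mono[OF assms, of 2] by simp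
  then have "1 - s\<^sup>2 \<ge> 1/2" by (simp add: power2_eq_square)
  then have "1 / (1 - s\<^sup>2) \<le> 2" by (simp add: field_simps)
  then show ?thesis using \<open>1 - s\<^sup>2 \<ge> 1/2\<close> by (simp add: bump_def flat_def)
qed

lemma bump_bounded: obtains B where "B > 0" "\<And>s. \<bar>bump s\<bar> \<le> B" "\<And>s. \<bar>bump' s\<bar> \<le> B"
proof -
  have "bounded (bump ` {-1..1} \<union> bump' ` {-1..1})"
    by (intro compact_imp_bounded compact_Un compact_continuous_image continuous_bump) auto
  then obtain B where B: "B > 0" "\<forall>x\<in>bump ` {-1..1} \<union> bump' ` {-1..1}. norm x \<le> B"
    unfolding bounded_pos by blast
  have "\<bar>bump s\<bar> \<le> B \<and> \<bar>bump' s\<bar> \<le> B" for s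
  proof (cases "\<bar>s\<bar> \<ge> 1")
    case False
    then have "s \<in> {-1..1}" by auto
    then show ?thesis using B(2) by fastforce
  qed (use B(1) bump_eq_0[of s] in auto)
  with B that show ?thesis by blast
qed

text \<open>
  Equality in the one-dimensional inequality \<open>(D/2)\<^sup>2 \<integral> u\<^sup>2 e\<^bsup>Ds\<^esup> ds \<le> \<integral> u'\<^sup>2 e\<^bsup>Ds\<^esup> ds\<close> would force
  \<open>u' = -(D/2) u\<close>, but for \<open>e\<^bsup>-Ds/2\<^esup>\<close> both integrals are infinite. It is cut off at scale \<open>L\<close>.
\<close>

definition profile :: "real \<Rightarrow> real \<Rightarrow> real \<Rightarrow> real" where
  "profile D L s = exp (-(D/2 * s)) * bump (s / L)"

definition profile' :: "real \<Rightarrow> real \<Rightarrow> real \<Rightarrow> real" where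
  "profile' D L s = exp (-(D/2 * s)) * (bump' (s / L) / L - D/2 * bump (s / L))"

lemma profile_has_derivative: "(profile D L has_real_derivative profile' D L s) (at s)"
proof -
  have "((\<lambda>s. bump (s / L)) has_real_derivative bump' (s / L) * (1 / L)) (at s)"
    by (rule DERIV_chain2[OF bump_has_derivative]) (auto intro!: derivative_eq_intros simp: divide_inverse)
  then show ?thesis
    unfolding profile_def[abs_def] profile'_def
    by (auto intro!: derivative_eq_intros simp: algebra_simps)
qed

lemma continuous_profile: "continuous_on S (profile D L)" "continuous_on S (profile' D L)"
proof -
  have "continuous_on S (\<lambda>s. bump (s / L))" "continuous_on S (\<lambda>s. bump' (s / L))"
    unfolding divide_inverse
    by (auto intro!: continuous_on_compose2[OF continuous_bump(1)[of UNIV]]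
        continuous_on_compose2[OF continuous_bump(2)[of UNIV]] continuous_intros)
  then show "continuous_on S (profile D L)" "continuous_on S (profile' D L)"
    unfolding profile_def[abs_def] profile'_def[abs_def] divide_inverse[of "bump' _"]
    by (auto intro!: continuous_intros)
qed

lemma profile_eq_0:
  assumes "L > 0" "\<bar>s\<bar> \<ge> L" shows "profile D L s = 0" "profile' D L s = 0"
proof -
  have "\<bar>s / L\<bar> \<ge> 1" using assms by simp
  from bump_eq_0[OF this] show "profile D L s = 0" "profile' D L s = 0"
    by (simp_all add: profile_def profile'_def)
qed

lemma profile_bounded:
  assumes "L > 0"
  obtains B where "B > 0" "\<And>s. \<bar>profile D L s\<bar> \<le> B" "\<And>s. \<bar>profile' D L s\<bar> \<le> B"
proof -
  have "bounded (profile D L ` {-L..L} \<union> profile' D L ` {-L..L})"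
    by (intro compact_imp_bounded compact_Un compact_continuous_image continuous_profile) auto
  then obtain B where B: "B > 0" "\<forall>x\<in>profile D L ` {-L..L} \<union> profile' D L ` {-L..L}. norm x \<le> B"
    unfolding bounded_pos by blast
  have "\<bar>profile D L s\<bar> \<le> B \<and> \<bar>profile' D L s\<bar> \<le> B" for s
  proof (cases "\<bar>s\<bar> \<ge> L")
    case False
    then have "s \<in> {-L..L}" by auto
    then show ?thesis using B(2) by fastforce
  qed (use B(1) profile_eq_0[OF assms, of s] in auto)
  with B that show ?thesis by blast
qed

lemma measurable_profile [measurable]:
  "profile D L \<in> borel_measurable borel" "profile' D L \<in> borel_measurable borel"
  by (intro borel_measurable_continuous_onI continuous_profile)+

text \<open>
  The cut-off at scale \<open>L\<close> has mass \<open>L\<close> times this integral, which must eventually dominate an error that stays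
  bounded as \<open>L\<close> grows.
\<close>

lemma bump_square_integral_pos: "(\<integral>\<^sup>+s. ennreal ((bump s)\<^sup>2) \<partial>lborel) > 0"
  and bump_square_integral_finite: "(\<integral>\<^sup>+s. ennreal ((bump s)\<^sup>2) \<partial>lborel) < \<infinity>"
proof -
  have "0 < (\<integral>\<^sup>+s. ennreal ((exp (-2))\<^sup>2) * indicator {-1/2..1/2::real} s \<partial>lborel)"
    by (subst nn_integral_cmult) (auto simp: ennreal_zero_less_mult_iff)
  also have "\<dots> \<le> (\<integral>\<^sup>+s. ennreal ((bump s)\<^sup>2) \<partial>lborel)"
  proof (intro nn_integral_mono)
    fix s :: real
    show "ennreal ((exp (-2))\<^sup>2) * indicator {-1/2..1/2} s \<le> ennreal ((bump s)\<^sup>2)"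
    proof (cases "\<bar>s\<bar> \<le> 1/2")
      case True
      have "(exp (-2))\<^sup>2 \<le> (bump s)\<^sup>2" by (intro power_mono bump_ge[OF True]) simp
      then have "ennreal ((exp (-2))\<^sup>2) \<le> ennreal ((bump s)\<^sup>2)" by (rule ennreal_leI)
      then show ?thesis by (rule order_trans[rotated]) (simp only: indicator_def mult_1_right split: if_split, simp)
    next
      case False
      then have "s \<notin> {-1/2..1/2}" by (auto simp: abs_le_iff)
      then show ?thesis by simp
    qed
  qed
  finally show "(\<integral>\<^sup>+s. ennreal ((bump s)\<^sup>2) \<partial>lborel) > 0" .
  obtain B where B: "B > 0" "\<And>s. \<bar>bump s\<bar> \<le> B" "\<And>s. \<bar>bump' s\<bar> \<le> B"
    by (rule bump_bounded) (rule that; assumption)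
  have "(\<integral>\<^sup>+s. ennreal ((bump s)\<^sup>2) \<partial>lborel) \<le> (\<integral>\<^sup>+s. ennreal (B\<^sup>2) * indicator {-1..1::real} s \<partial>lborel)"
  proof (intro nn_integral_mono)
    fix s
    have "(bump s)\<^sup>2 \<le> B\<^sup>2" using B by (intro abs_le_square_iff[THEN iffD1]) auto
    then show "ennreal ((bump s)\<^sup>2) \<le> ennreal (B\<^sup>2) * indicator {-1..1} s"
      using bump_eq_0[of s] by (cases "\<bar>s\<bar> \<ge> 1") (auto simp: indicator_def ennreal_leI abs_le_iff)
  qed
  also have "\<dots> < \<infinity>" by (subst nn_integral_cmult) (auto simp: ennreal_mult_less_top)
  finally show "(\<integral>\<^sup>+s. ennreal ((bump s)\<^sup>2) \<partial>lborel) < \<infinity>" .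
qed

text \<open>
  After the exponential factors cancel and \<open>s\<close> is replaced by \<open>L s\<close>, the two sides are \<open>L\<close> times the integrals of
  \<open>(b'/L - D b/2)\<^sup>2\<close> and of \<open>C b\<^sup>2\<close>, where \<open>b\<close> is the bump. The first of these integrals exceeds
  \<open>(D/2)\<^sup>2 \<integral> b\<^sup>2\<close> by \<open>O(1/L)\<close> only.
\<close>

lemma ex_profile_nearly_optimal:
  assumes D: "D > 0" and C: "C > (D/2)\<^sup>2"
  shows "\<exists>L>0. (\<integral>\<^sup>+s. ennreal ((profile' D L s)\<^sup>2) * ennreal (exp (D * s)) \<partial>lborel)
    < ennreal C * (\<integral>\<^sup>+s. ennreal ((profile D L s)\<^sup>2) * ennreal (exp (D * s)) \<partial>lborel)"
proof -
  define I where "I = enn2real (\<integral>\<^sup>+s. ennreal ((bump s)\<^sup>2) \<partial>lborel)"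
  have I: "(\<integral>\<^sup>+s. ennreal ((bump s)\<^sup>2) \<partial>lborel) = ennreal I" "I > 0"
    using bump_square_integral_pos bump_square_integral_finite
    by (simp_all add: I_def enn2real_positive_iff)
  have [measurable]: "bump \<in> borel_measurable borel" "bump' \<in> borel_measurable borel"
    by (intro borel_measurable_continuous_onI continuous_bump)+
  obtain B where B: "B > 0" "\<And>s. \<bar>bump s\<bar> \<le> B" "\<And>s. \<bar>bump' s\<bar> \<le> B"
    by (rule bump_bounded) (rule that; assumption)
  have "C > 0" using C zero_le_power2[of "D/2"] by linarith
  define K where "K = B\<^sup>2 + D * B\<^sup>2"
  have K: "K > 0" using B D by (simp add: K_def add_pos_pos)
  \<comment> \<open>Here \<open>K\<close> bounds \<open>L\<close> times the excess of the integrand over its main part, and the support of the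
    bump has length \<open>2\<close>; the factor \<open>4\<close> makes the total excess \<open>2 K / L\<close> strictly smaller than the gap.\<close>
  define L where "L = max 1 (4 * K / ((C - (D/2)\<^sup>2) * I))"
  have L: "L \<ge> 1" by (simp add: L_def)
  have CI: "(C - (D/2)\<^sup>2) * I > 0" using C I by simp
  have "4 * K / ((C - (D/2)\<^sup>2) * I) \<le> L" by (simp add: L_def)
  then have "4 * K \<le> L * ((C - (D/2)\<^sup>2) * I)" using CI by (simp add: divide_le_eq)
  then have small: "2 * K / L < (C - (D/2)\<^sup>2) * I" using K L CI by (simp add: divide_less_eq mult.commute)
  have ex: "(exp (-(D/2 * s)))\<^sup>2 * exp (D * s) = 1" for s :: real
    unfolding exp_double[symmetric] exp_add[symmetric] by simp
  have sq: "(exp (-(D/2 * s)) * b)\<^sup>2 * exp (D * s) = b\<^sup>2" for s b :: real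
  proof -
    have "(exp (-(D/2 * s)) * b)\<^sup>2 * exp (D * s) = ((exp (-(D/2 * s)))\<^sup>2 * exp (D * s)) * b\<^sup>2"
      by (simp only: power_mult_distrib mult_ac)
    then show ?thesis by (simp only: ex mult_1_left)
  qed
  have scale: "(\<integral>\<^sup>+s. ennreal (G (s / L)) \<partial>lborel) = ennreal L * (\<integral>\<^sup>+s. ennreal (G s) \<partial>lborel)"
    if [measurable]: "G \<in> borel_measurable borel" for G :: "real \<Rightarrow> real"
    using L by (subst nn_integral_real_affine[where c=L and t=0]) auto
  have "(\<integral>\<^sup>+s. ennreal ((profile D L s)\<^sup>2) * ennreal (exp (D * s)) \<partial>lborel) = (\<integral>\<^sup>+s. ennreal ((bump (s / L))\<^sup>2) \<partial>lborel)"
  proof (intro nn_integral_cong)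
    fix s
    have "(profile D L s)\<^sup>2 * exp (D * s) = (bump (s / L))\<^sup>2" unfolding profile_def by (rule sq)
    then show "ennreal ((profile D L s)\<^sup>2) * ennreal (exp (D * s)) = ennreal ((bump (s / L))\<^sup>2)"
      by (simp add: ennreal_mult[symmetric])
  qed
  also have "\<dots> = ennreal L * ennreal I" using scale[of "\<lambda>s. (bump s)\<^sup>2"] I by simp
  finally have mass: "(\<integral>\<^sup>+s. ennreal ((profile D L s)\<^sup>2) * ennreal (exp (D * s)) \<partial>lborel) = ennreal L * ennreal I" .
  have "(\<integral>\<^sup>+s. ennreal ((profile' D L s)\<^sup>2) * ennreal (exp (D * s)) \<partial>lborel)
      = (\<integral>\<^sup>+s. ennreal ((bump' (s / L) / L - D/2 * bump (s / L))\<^sup>2) \<partial>lborel)"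
  proof (intro nn_integral_cong)
    fix s
    have "(profile' D L s)\<^sup>2 * exp (D * s) = (bump' (s / L) / L - D/2 * bump (s / L))\<^sup>2"
      unfolding profile'_def by (rule sq)
    then show "ennreal ((profile' D L s)\<^sup>2) * ennreal (exp (D * s)) = ennreal ((bump' (s / L) / L - D/2 * bump (s / L))\<^sup>2)"
      by (simp add: ennreal_mult[symmetric])
  qed
  also have "\<dots> = ennreal L * (\<integral>\<^sup>+s. ennreal ((bump' s / L - D/2 * bump s)\<^sup>2) \<partial>lborel)"
    using scale[of "\<lambda>s. (bump' s / L - D/2 * bump s)\<^sup>2"] by simp
  also have "\<dots> \<le> ennreal L * (\<integral>\<^sup>+s. ennreal ((D/2)\<^sup>2) * ennreal ((bump s)\<^sup>2) + ennreal (K / L) * indicator {-1..1} s \<partial>lborel)"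
  proof (intro mult_left_mono nn_integral_mono)
    fix s
    show "ennreal ((bump' s / L - D/2 * bump s)\<^sup>2) \<le> ennreal ((D/2)\<^sup>2) * ennreal ((bump s)\<^sup>2) + ennreal (K / L) * indicator {-1..1} s"
    proof (cases "\<bar>s\<bar> \<ge> 1")
      case True then show ?thesis by (simp add: bump_eq_0)
    next
      case False
      have "(bump' s / L - D/2 * bump s)\<^sup>2 = (D/2)\<^sup>2 * (bump s)\<^sup>2 + ((bump' s)\<^sup>2 / L - D * (bump s * bump' s)) / L"
        using L by (simp add: power2_eq_square field_simps)
      also have "\<dots> \<le> (D/2)\<^sup>2 * (bump s)\<^sup>2 + K / L"
      proof (intro add_left_mono divide_right_mono)
        have "(bump' s)\<^sup>2 / L \<le> (bump' s)\<^sup>2 / 1" using L by (intro divide_left_mono) auto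
        also have "\<dots> \<le> B\<^sup>2" using B by (simp add: abs_le_square_iff[symmetric])
        finally have "(bump' s)\<^sup>2 / L \<le> B\<^sup>2" .
        moreover have "\<bar>bump s\<bar> * \<bar>bump' s\<bar> \<le> B * B" using B by (intro mult_mono) auto
        then have "- (bump s * bump' s) \<le> B\<^sup>2" by (simp add: power2_eq_square abs_mult[symmetric])
        then have "D * (- (bump s * bump' s)) \<le> D * B\<^sup>2" using D by (intro mult_left_mono) auto
        ultimately show "(bump' s)\<^sup>2 / L - D * (bump s * bump' s) \<le> K" by (simp add: K_def)
      qed (use L in simp)
      finally have "ennreal ((bump' s / L - D/2 * bump s)\<^sup>2) \<le> ennreal ((D/2)\<^sup>2 * (bump s)\<^sup>2 + K / L)"
        by (rule ennreal_leI)
      also have "\<dots> = ennreal ((D/2)\<^sup>2) * ennreal ((bump s)\<^sup>2) + ennreal (K / L)"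
        using K L by (simp add: ennreal_mult)
      also have "indicator {-1..1} s = (1::ennreal)" using False by (auto simp: indicator_def)
      then have "ennreal (K / L) = ennreal (K / L) * indicator {-1..1} s" by simp
      finally show ?thesis .
    qed
  qed simp
  also have "\<dots> = ennreal L * (ennreal ((D/2)\<^sup>2) * ennreal I + ennreal (K / L) * 2)"
    by (simp add: nn_integral_add nn_integral_cmult I)
  also have "\<dots> = ennreal (L * ((D/2)\<^sup>2 * I + 2 * K / L))"
  proof -
    have "ennreal (K / L) * 2 = ennreal (2 * K / L)"
      using K L ennreal_mult[of "K / L" 2] by (simp add: mult.commute)
    then show ?thesis using L K I D by (simp add: ennreal_mult ennreal_plus mult.commute)
  qed
  also have "\<dots> < ennreal (L * (C * I))"
    using L small I K \<open>C > 0\<close> by (intro ennreal_lessI mult_strict_left_mono) (auto simp: algebra_simps zero_less_mult_iff)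
  also have "\<dots> = ennreal C * (ennreal L * ennreal I)"
    using L I \<open>C > 0\<close> by (simp add: ennreal_mult mult_ac)
  finally show ?thesis unfolding mass[symmetric] using L by (intro exI[of _ L]) auto
qed

section \<open>Smooth trial functions approximating functions of the gauge\<close>

lemma Ck_on_log_gauge:
  assumes "\<gamma> \<ge> 0" "\<epsilon> \<noteq> 0" shows "Ck_on k UNIV (log_gauge \<gamma> \<epsilon> :: (real^'m) \<times> (real^'k) \<Rightarrow> real)"
proof -
  have pos: "(norm (fst z))\<^sup>2 + \<epsilon>\<^sup>2 > 0" for z :: "(real^'m) \<times> (real^'k)"
    using assms by (simp add: add_nonneg_pos)
  have "Ck_on k UNIV (\<lambda>z :: (real^'m) \<times> (real^'k). (fst z \<bullet> fst z) + \<epsilon>\<^sup>2)" for k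
    by (intro Ck_on_add Ck_on_const bounded_bilinear.Ck_on_prod[OF bounded_bilinear_inner]
        Ck_on_bounded_linear bounded_linear_fst)
  then have "Ck_on k UNIV (\<lambda>z :: (real^'m) \<times> (real^'k). ((norm (fst z))\<^sup>2 + \<epsilon>\<^sup>2) powr (1+\<gamma>))" for k
    using pos by (intro Ck_on_powr) (simp_all add: power2_norm_eq_inner)
  moreover have "Ck_on k UNIV (\<lambda>z :: (real^'m) \<times> (real^'k). (1+\<gamma>)\<^sup>2 * (norm (snd z))\<^sup>2)" for k
    unfolding power2_norm_eq_inner
    by (intro bounded_bilinear.Ck_on_prod[OF bounded_bilinear_mult] Ck_on_const
        bounded_bilinear.Ck_on_prod[OF bounded_bilinear_inner] Ck_on_bounded_linear bounded_linear_snd)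
  ultimately have "Ck_on k UNIV (gauge_power \<gamma> \<epsilon> :: (real^'m) \<times> (real^'k) \<Rightarrow> real)" for k
    unfolding gauge_power_def[abs_def] by (intro Ck_on_add)
  then have "Ck_on k UNIV (\<lambda>z :: (real^'m) \<times> (real^'k). (1 / (2 * (1+\<gamma>))) * ln (gauge_power \<gamma> \<epsilon> z))"
    using assms by (intro bounded_bilinear.Ck_on_prod[OF bounded_bilinear_mult] Ck_on_const Ck_on_ln gauge_power_pos) auto
  then show ?thesis by (simp add: log_gauge_def[abs_def])
qed

definition trial :: "real \<Rightarrow> real \<Rightarrow> real \<Rightarrow> real \<Rightarrow> (real^'m) \<times> (real^'k) \<Rightarrow> complex" where
  "trial D L \<gamma> \<epsilon> z = complex_of_real (profile D L (log_gauge \<gamma> \<epsilon> z))"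

lemma smooth_trial:
  assumes "\<gamma> \<ge> 0" "\<epsilon> \<noteq> 0" shows "smooth_on S (trial D L \<gamma> \<epsilon> :: (real^'m) \<times> (real^'k) \<Rightarrow> complex)"
proof -
  let ?l = "log_gauge \<gamma> \<epsilon> :: (real^'m) \<times> (real^'k) \<Rightarrow> real"
  note mult = bounded_bilinear.Ck_on_prod[OF bounded_bilinear_mult]
  have l: "Ck_on k UNIV ?l" for k using Ck_on_log_gauge[OF assms] .
  have lin: "Ck_on k UNIV (\<lambda>z. c * ?l z)" for c k
    by (rule mult[OF Ck_on_const l])
  have "Ck_on k UNIV (\<lambda>z. 1 + (-1 / L * ?l z) * (1 / L * ?l z))" for k
    by (rule Ck_on_add[OF Ck_on_const mult[OF lin lin]])
  then have "Ck_on k UNIV (\<lambda>z. flat 1 (1 + (-1 / L * ?l z) * (1 / L * ?l z)))" for k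
    by (rule Ck_on_flat)
  moreover have "(\<lambda>z. flat 1 (1 + (-1 / L * ?l z) * (1 / L * ?l z))) = (\<lambda>z. bump (?l z / L))"
    by (simp add: bump_def power2_eq_square)
  ultimately have "Ck_on k UNIV (\<lambda>z. bump (?l z / L))" for k by simp
  from mult[OF Ck_on_exp[OF lin] this] have "Ck_on k UNIV (\<lambda>z. exp ((-(D/2)) * ?l z) * bump (?l z / L))" for k .
  then have "Ck_on k UNIV (\<lambda>z. profile D L (?l z))" for k
    by (simp add: profile_def)
  from bounded_bilinear.Ck_on_prod[OF bounded_bilinear_scaleR this Ck_on_const[of _ "1::complex"]]
  have "Ck_on k UNIV (trial D L \<gamma> \<epsilon> :: (real^'m) \<times> (real^'k) \<Rightarrow> complex)" for k
    by (simp add: trial_def[abs_def] of_real_def)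
  then show ?thesis unfolding smooth_on_def using Ck_on_subset by blast
qed

lemma log_gauge_at_0: "\<gamma> \<ge> 0 \<Longrightarrow> \<epsilon> > 0 \<Longrightarrow> log_gauge \<gamma> \<epsilon> 0 = ln \<epsilon>"
  by (simp add: log_gauge_def gauge_power_def powr_def ln_realpow field_simps)

text \<open>
  The regularised gauge equals \<open>\<epsilon>\<close> at the origin. For \<open>\<epsilon> < e\<^bsup>-L\<^esup>\<close> its logarithm there is below \<open>-L\<close>, outside
  the support of the profile, so the origin is not in the support of the trial function.
\<close>

lemma test_function_trial:
  assumes \<gamma>: "\<gamma> \<ge> 0" and L: "L > 0" and \<epsilon>: "\<epsilon> > 0" "\<epsilon> < exp (-L)"
  shows "test_function_on (UNIV - {0}) (trial D L \<gamma> \<epsilon> :: (real^'m) \<times> (real^'k) \<Rightarrow> complex)"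
proof -
  let ?f = "trial D L \<gamma> \<epsilon> :: (real^'m) \<times> (real^'k) \<Rightarrow> complex"
  let ?K = "{z :: (real^'m) \<times> (real^'k). \<bar>log_gauge \<gamma> \<epsilon> z\<bar> \<le> L}"
  have "continuous_on UNIV (log_gauge \<gamma> \<epsilon> :: (real^'m) \<times> (real^'k) \<Rightarrow> real)"
    using Ck_on_log_gauge[OF \<gamma>, of \<epsilon> 0] \<epsilon> by simp
  then have closed: "closed ?K"
    by (intro closed_Collect_le continuous_intros)
  have "norm z \<le> exp L + exp ((1+\<gamma>) * L)" if "z \<in> ?K" for z
    using norm_le_of_log_gauge_le[OF \<gamma>, of z \<epsilon> L] that \<epsilon> norm_Pair_le[of "fst z" "snd z"] by fastforce
  then have "bounded ?K" unfolding bounded_iff by blast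
  with closed have "compact ?K" by (simp add: compact_eq_bounded_closed)
  have supp: "closure {z. ?f z \<noteq> 0} \<subseteq> ?K"
  proof (rule closure_minimal[OF _ closed])
    show "{z. ?f z \<noteq> 0} \<subseteq> ?K"
      using profile_eq_0(1)[OF L] by (force simp: trial_def)
  qed
  have "ln \<epsilon> < ln (exp (-L))" using \<epsilon> by (subst ln_less_cancel_iff) auto
  then have "ln \<epsilon> < -L" by simp
  then have "0 \<notin> ?K" using L by (simp add: log_gauge_at_0[OF \<gamma> \<epsilon>(1)] abs_le_iff)
  moreover have "compact (closure {z. ?f z \<noteq> 0})"
    using compact_Int_closed[OF \<open>compact ?K\<close> closed_closure[of "{z. ?f z \<noteq> 0}"]] supp
    by (simp only: Int_absorb1)
  moreover have "smooth_on (UNIV - {0}) ?f" by (rule smooth_trial[OF \<gamma>]) (use \<epsilon> in simp)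
  ultimately show ?thesis unfolding test_function_on_def using supp by blast
qed

text \<open>
  With \<open>A = |x|\<^sup>2 + \<epsilon>\<^sup>2\<close> and \<open>P = A\<^bsup>1+\<gamma>\<^esup> + (1+\<gamma>)\<^sup>2 |y|\<^sup>2\<close> the energy density is
  \<open>u'\<^sup>2 (A\<^bsup>2\<gamma>\<^esup> |x|\<^sup>2 + |x|\<^bsup>2\<gamma>\<^esup> (1+\<gamma>)\<^sup>2 |y|\<^sup>2) / P\<^sup>2\<close>, and \<open>|x|\<^sup>2 \<le> A\<close> bounds the bracket by \<open>A\<^sup>\<gamma> P\<close>. The bound becomes an
  equality for \<open>\<epsilon> = 0\<close>, so nothing is lost in the limit.
\<close>

lemma trial_energy_density_le:
  fixes z :: "(real^'m) \<times> (real^'k)"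
  assumes \<gamma>: "\<gamma> \<ge> 0" and z: "fst z \<noteq> 0"
  shows "(cmod (radial_deriv_x (trial D L \<gamma> \<epsilon>) z))\<^sup>2 + norm (fst z) powr (2 * \<gamma>) * (norm (grad_y (trial D L \<gamma> \<epsilon>) z))\<^sup>2
    \<le> (profile' D L (log_gauge \<gamma> \<epsilon> z))\<^sup>2 * (((norm (fst z))\<^sup>2 + \<epsilon>\<^sup>2) powr \<gamma> / gauge_power \<gamma> \<epsilon> z)"
proof -
  let ?A = "(norm (fst z))\<^sup>2 + \<epsilon>\<^sup>2" and ?P = "gauge_power \<gamma> \<epsilon> z" and ?u = "profile' D L (log_gauge \<gamma> \<epsilon> z)"
  have A: "?A > 0" using z by (simp add: add_pos_nonneg)
  have P: "?P > 0" using gauge_power_pos_of_fst[OF \<gamma> z] .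
  have "((\<lambda>z. profile D L (log_gauge \<gamma> \<epsilon> z)) has_derivative
      (\<lambda>v. ?u * ((?A powr \<gamma> * (fst z \<bullet> fst v) + (1+\<gamma>) * (snd z \<bullet> snd v)) / ?P))) (at z)"
    by (rule has_derivative_compose[OF has_derivative_log_gauge profile_has_derivative[unfolded has_field_derivative_def]])
       (use \<gamma> z in auto)
  then have der: "(trial D L \<gamma> \<epsilon> has_derivative
      (\<lambda>v. complex_of_real (?u * ((?A powr \<gamma> * (fst z \<bullet> fst v) + (1+\<gamma>) * (snd z \<bullet> snd v)) / ?P)))) (at z)"
    unfolding trial_def[abs_def] by (rule has_derivative_of_real)
  have r: "cmod (radial_deriv_x (trial D L \<gamma> \<epsilon>) z) = \<bar>?u * (?A powr \<gamma> * norm (fst z) / ?P)\<bar>"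
  proof -
    have "fst z \<bullet> (fst z /\<^sub>R norm (fst z)) = norm (fst z)"
      using z by (simp add: power2_norm_eq_inner[symmetric] power2_eq_square)
    then show ?thesis
      unfolding radial_deriv_x_eq[OF der]
      by (simp only: fst_conv snd_conv inner_zero_right mult_zero_right add_0_right norm_of_real)
  qed
  have "norm (grad_y (trial D L \<gamma> \<epsilon>) z) = norm (\<chi> j. complex_of_real ((?u * (1+\<gamma>) / ?P) * snd z $ j))"
    unfolding grad_y_eq[OF der] by (simp add: inner_axis mult_ac)
  also have "\<dots> = \<bar>?u * (1+\<gamma>) / ?P\<bar> * norm (snd z)"
  proof -
    have "norm (\<chi> j. complex_of_real (c * y $ j)) = \<bar>c\<bar> * norm y" for c and y :: "real^'k"
      unfolding norm_vec_def vec_lambda_beta norm_of_real abs_mult real_norm_def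
      by (simp add: L2_set_right_distrib)
    then show ?thesis .
  qed
  finally have g: "norm (grad_y (trial D L \<gamma> \<epsilon>) z) = \<bar>?u * (1+\<gamma>) / ?P\<bar> * norm (snd z)" .
  have "(cmod (radial_deriv_x (trial D L \<gamma> \<epsilon>) z))\<^sup>2 + norm (fst z) powr (2 * \<gamma>) * (norm (grad_y (trial D L \<gamma> \<epsilon>) z))\<^sup>2
    = (?u / ?P)\<^sup>2 * ((?A powr \<gamma>)\<^sup>2 * (norm (fst z))\<^sup>2 + norm (fst z) powr (2 * \<gamma>) * ((1+\<gamma>)\<^sup>2 * (norm (snd z))\<^sup>2))"
  proof -
    have "\<bar>u * (A * x / P)\<bar>\<^sup>2 + q * (\<bar>u * g / P\<bar> * y)\<^sup>2 = (u / P)\<^sup>2 * (A\<^sup>2 * x\<^sup>2 + q * (g\<^sup>2 * y\<^sup>2))"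
      for u A x P q g y :: real
      by (simp add: divide_inverse power_mult_distrib algebra_simps)
    then show ?thesis unfolding r g .
  qed
  also have "\<dots> \<le> (?u / ?P)\<^sup>2 * (?A powr \<gamma> * ?P)"
  proof (rule mult_left_mono)
    have "norm (fst z) powr (2 * \<gamma>) = ((norm (fst z))\<^sup>2) powr \<gamma>"
      using powr_powr[of "norm (fst z)" 2 \<gamma>] z by simp
    also have "\<dots> \<le> ?A powr \<gamma>" using \<gamma> by (intro powr_mono2) auto
    finally have "norm (fst z) powr (2 * \<gamma>) * ((1+\<gamma>)\<^sup>2 * (norm (snd z))\<^sup>2) \<le> ?A powr \<gamma> * ((1+\<gamma>)\<^sup>2 * (norm (snd z))\<^sup>2)"
      by (rule mult_right_mono) simp
    moreover have "(?A powr \<gamma>)\<^sup>2 * (norm (fst z))\<^sup>2 \<le> (?A powr \<gamma>)\<^sup>2 * ?A"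
      by (intro mult_left_mono) auto
    moreover have "(?A powr \<gamma>)\<^sup>2 * ?A = ?A powr \<gamma> * ?A powr (1+\<gamma>)"
      using A by (simp add: powr_add power2_eq_square)
    ultimately show "(?A powr \<gamma>)\<^sup>2 * (norm (fst z))\<^sup>2 + norm (fst z) powr (2 * \<gamma>) * ((1+\<gamma>)\<^sup>2 * (norm (snd z))\<^sup>2) \<le> ?A powr \<gamma> * ?P"
      unfolding gauge_power_def distrib_left[of "?A powr \<gamma>" "?A powr (1+\<gamma>)"] by linarith
  qed simp
  also have "\<dots> = ?u\<^sup>2 * (?A powr \<gamma> / ?P)" using P by (simp add: power2_eq_square)
  finally show ?thesis .
qed

text \<open>
  Since \<open>A \<le> \<rho>\<^sub>\<epsilon>\<^sup>2\<close>, the quotient is at most \<open>\<rho>\<^sub>\<epsilon>\<^bsup>-2\<^esup>\<close>, a bound that is uniform in \<open>\<epsilon>\<close> on the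
  support of the profile. It provides the majorant for dominated convergence.
\<close>

lemma powr_div_gauge_power_le:
  assumes \<gamma>: "\<gamma> \<ge> 0" and z: "fst z \<noteq> 0"
  shows "((norm (fst z))\<^sup>2 + \<epsilon>\<^sup>2) powr \<gamma> / gauge_power \<gamma> \<epsilon> z \<le> exp (- (2 * log_gauge \<gamma> \<epsilon> z))"
proof -
  let ?A = "(norm (fst z))\<^sup>2 + \<epsilon>\<^sup>2" and ?P = "gauge_power \<gamma> \<epsilon> z" and ?l = "log_gauge \<gamma> \<epsilon> z"
  have A: "?A > 0" using z by (simp add: add_pos_nonneg)
  have P: "?P = exp (2 * (1+\<gamma>) * ?l)" by (rule gauge_power_eq_exp_log_gauge[OF \<gamma>]) (use z in auto)
  have "?A powr (1+\<gamma>) \<le> ?P" by (simp add: gauge_power_def)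
  then have "(1+\<gamma>) * ln ?A \<le> (1+\<gamma>) * (2 * ?l)"
    using A z by (simp add: P powr_def algebra_simps)
  then have "ln ?A \<le> 2 * ?l" using \<gamma> by simp
  then have "?A powr \<gamma> \<le> exp (\<gamma> * (2 * ?l))"
    using A \<gamma> by (simp add: powr_def mult_left_mono)
  then have "?A powr \<gamma> / ?P \<le> exp (\<gamma> * (2 * ?l)) / ?P" by (simp add: P divide_right_mono)
  also have "\<dots> = exp (- (2 * ?l))" unfolding P exp_diff[symmetric] by (simp add: algebra_simps)
  finally show ?thesis .
qed

lemma log_gauge_mono:
  assumes "\<gamma> \<ge> 0" "fst z \<noteq> 0" shows "log_gauge \<gamma> 0 z \<le> log_gauge \<gamma> \<epsilon> z"
proof -
  have "gauge_power \<gamma> 0 z \<le> gauge_power \<gamma> \<epsilon> z"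
    unfolding gauge_power_def using assms by (intro add_right_mono powr_mono2) auto
  then show ?thesis
    using gauge_power_pos_of_fst[OF assms, of 0] assms(1) by (simp add: log_gauge_def divide_right_mono)
qed

lemma tendsto_gauge_power:
  assumes "(e \<longlongrightarrow> 0) F" "fst z \<noteq> 0" shows "((\<lambda>n. gauge_power \<gamma> (e n) z) \<longlongrightarrow> gauge_power \<gamma> 0 z) F"
  unfolding gauge_power_def using assms by (intro tendsto_intros) auto

lemma tendsto_log_gauge:
  assumes "(e \<longlongrightarrow> 0) F" "fst z \<noteq> 0" "\<gamma> \<ge> 0" shows "((\<lambda>n. log_gauge \<gamma> (e n) z) \<longlongrightarrow> log_gauge \<gamma> 0 z) F"
  unfolding log_gauge_def using assms gauge_power_pos_of_fst[of \<gamma> z 0] by (intro tendsto_intros tendsto_gauge_power) auto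


section \<open>Sharpness of the constant\<close>

text \<open>
  In order to cancel the mass \<open>c\<close> of the unit sphere one needs \<open>0 < c < \<infinity>\<close>. It is finite since the weight is integrable
  near the origin; if it were zero, the polar formula would make the weight vanish almost everywhere.
\<close>

lemma ex_polar_constant:
  assumes \<gamma>: "\<gamma> \<ge> 0" and p: "real CARD('m) + p > 0"
    and D: "D = real CARD('m) + (1+\<gamma>) * real CARD('k) + (a + p)" "D > 0"
  shows "\<exists>c>0. c < \<infinity> \<and> (\<forall>G \<in> borel_measurable borel.
    (\<integral>\<^sup>+z. ennreal (gauge_weight \<gamma> a p z) * G (log_gauge \<gamma> 0 (z :: (real^'m) \<times> (real^'k))) \<partial>lborel)
      = c * (\<integral>\<^sup>+s. G s * ennreal (exp (D * s)) \<partial>lborel))"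
proof -
  let ?M = "density lborel (\<lambda>z::(real^'m) \<times> (real^'k). ennreal (gauge_weight \<gamma> a p z))"
  interpret dilation_measure ?M "dilate \<gamma>" D
    unfolding D(1) by (rule dilation_measure_weight[OF \<gamma>])
  define c where "c = (\<integral>\<^sup>+z. indicator {0..1} (log_gauge \<gamma> 0 z) * ennreal (exp (-(D * log_gauge \<gamma> 0 z))) \<partial>?M)"
  have shift: "AE z in ?M. log_gauge \<gamma> 0 (dilate \<gamma> t z) = log_gauge \<gamma> 0 z + t" for t
    using AE_lborel_singleton[of "0::(real^'m) \<times> (real^'k)"]
    by (simp add: AE_density) (auto elim!: eventually_mono simp: log_gauge_dilate[OF \<gamma>])
  have polar: "(\<integral>\<^sup>+z. ennreal (gauge_weight \<gamma> a p z) * G (log_gauge \<gamma> 0 (z :: (real^'m) \<times> (real^'k))) \<partial>lborel)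
      = c * (\<integral>\<^sup>+s. G s * ennreal (exp (D * s)) \<partial>lborel)" if [measurable]: "G \<in> borel_measurable borel" for G
  proof -
    have "(\<integral>\<^sup>+z. ennreal (gauge_weight \<gamma> a p z) * G (log_gauge \<gamma> 0 (z :: (real^'m) \<times> (real^'k))) \<partial>lborel) = (\<integral>\<^sup>+z. G (log_gauge \<gamma> 0 z) \<partial>?M)"
      by (rule nn_integral_density[symmetric]) measurable
    also have "\<dots> = c * (\<integral>\<^sup>+s. G s * ennreal (exp (D * s)) \<partial>lborel)"
      unfolding c_def by (rule nn_integral_polar[OF _ _ shift]) measurable
    finally show ?thesis .
  qed
  have "c = (\<integral>\<^sup>+z. ennreal (gauge_weight \<gamma> a p (z :: (real^'m) \<times> (real^'k))) * (indicator {0..1} (log_gauge \<gamma> 0 z) * ennreal (exp (-(D * log_gauge \<gamma> 0 z)))) \<partial>lborel)"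
    unfolding c_def by (rule nn_integral_density) measurable
  also have "\<dots> \<le> (\<integral>\<^sup>+z. ennreal (gauge_weight \<gamma> a p z) * indicator {z. log_gauge \<gamma> 0 z \<le> 1} (z::(real^'m) \<times> (real^'k)) \<partial>lborel)"
    using D(2) by (intro nn_integral_mono mult_left_mono) (auto simp: indicator_def intro!: ennreal_le_1[THEN iffD2])
  also have "\<dots> < \<infinity>"
    by (rule nn_integral_weight_sublevel_finite[OF \<gamma> p]) (use D in simp)
  finally have "c < \<infinity>" .
  moreover have "c \<noteq> 0"
  proof
    assume "c = 0"
    then have "(\<integral>\<^sup>+z. ennreal (gauge_weight \<gamma> a p (z :: (real^'m) \<times> (real^'k))) \<partial>lborel) = 0"
      using polar[of "\<lambda>_. 1"] by simp
    then have "AE z in lborel. gauge_weight \<gamma> a p (z :: (real^'m) \<times> (real^'k)) = 0"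
      by (subst (asm) nn_integral_0_iff_AE) (auto simp: ennreal_eq_0_iff elim!: eventually_mono intro: antisym[OF _ weight_nonneg])
    with AE_fst_nonzero have "AE z in (lborel :: ((real^'m) \<times> (real^'k)) measure). False"
      by eventually_elim (simp add: gauge_weight_def)
    then have "emeasure (lborel :: ((real^'m) \<times> (real^'k)) measure) UNIV = 0"
      by (simp add: AE_iff_measurable[OF _ refl])
    then show False by simp
  qed
  ultimately show ?thesis using polar by (intro exI[of _ c]) (auto simp: zero_less_iff_neq_zero)
qed

text \<open>
  Apply the hypothesis to the trial functions with \<open>\<epsilon> \<rightarrow> 0\<close>. Mass and energy bound converge by dominated
  convergence to \<open>\<integral> W u(ln \<rho>)\<^sup>2\<close> and \<open>\<integral> W u'(ln \<rho>)\<^sup>2\<close>, and the polar formula turns both into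
  one-dimensional integrals with the same constant \<open>c\<close>.
\<close>

lemma hardy_constant_bounds_profile:
  fixes \<alpha>1 \<alpha>2 :: real
  assumes \<gamma>: "\<gamma> \<ge> 0" and p: "real CARD('m) + \<gamma> * \<alpha>2 > 0"
    and D: "D = real CARD('m) + (1+\<gamma>) * real CARD('k) + \<alpha>1 - 2" "D > 0" and "L > 0"
    and hardy: "\<And>f :: (real^'m) \<times> (real^'k) \<Rightarrow> complex. test_function_on (UNIV - {0}) f \<Longrightarrow>
        ennreal C * hardy_mass \<gamma> \<alpha>1 \<alpha>2 f \<le> hardy_energy \<gamma> \<alpha>1 \<alpha>2 f"
  shows "ennreal C * (\<integral>\<^sup>+s. ennreal ((profile D L s)\<^sup>2) * ennreal (exp (D * s)) \<partial>lborel)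
    \<le> (\<integral>\<^sup>+s. ennreal ((profile' D L s)\<^sup>2) * ennreal (exp (D * s)) \<partial>lborel)"
proof -
  let ?a = "\<alpha>1 - \<gamma> * \<alpha>2" and ?p = "\<gamma> * \<alpha>2"
  let ?a' = "?a - 2 * (1+\<gamma>)" and ?p' = "?p + 2 * \<gamma>"
  let ?W = "\<lambda>z :: (real^'m) \<times> (real^'k). gauge_weight \<gamma> ?a' ?p' z"
  let ?w = "\<lambda>z :: (real^'m) \<times> (real^'k). gauge_weight \<gamma> ?a ?p z"
  let ?l = "\<lambda>\<epsilon> (z :: (real^'m) \<times> (real^'k)). log_gauge \<gamma> \<epsilon> z"
  let ?S = "{z :: (real^'m) \<times> (real^'k). log_gauge \<gamma> 0 z \<le> L}"
  \<comment> \<open>Every term stays below \<open>e\<^bsup>-L\<^esup>\<close>, so all trial functions are admissible.\<close>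
  define e where "e n = exp (-L) / real (n + 2)" for n
  have e: "e n > 0" "e n < exp (-L)" for n by (auto simp: e_def divide_less_eq)
  have e0: "e \<longlonglongrightarrow> 0" unfolding e_def by real_asymp
  obtain B where B: "B > 0" "\<And>s. \<bar>profile D L s\<bar> \<le> B" "\<And>s. \<bar>profile' D L s\<bar> \<le> B"
    by (rule profile_bounded[OF \<open>L > 0\<close>]) (rule that; assumption)
  have B2: "(profile D L s)\<^sup>2 \<le> B\<^sup>2" "(profile' D L s)\<^sup>2 \<le> B\<^sup>2" for s
    using B by (simp_all add: abs_le_square_iff[symmetric])
  have vanish: "profile D L (?l \<epsilon> z) = 0" "profile' D L (?l \<epsilon> z) = 0" if "fst z \<noteq> 0" "\<not> ?l 0 z \<le> L" for \<epsilon> z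
    using that log_gauge_mono[OF \<gamma> that(1), of \<epsilon>] profile_eq_0[OF \<open>L > 0\<close>, of "?l \<epsilon> z"] by auto
  have cont: "isCont (profile D L) s" "isCont (profile' D L) s" for s
    using continuous_profile[of UNIV] by (auto simp: continuous_on_eq_continuous_at)

  let ?f = "\<lambda>n. trial D L \<gamma> (e n) :: (real^'m) \<times> (real^'k) \<Rightarrow> complex"
  define m where "m n z = ennreal (?W z * (profile D L (?l (e n) z))\<^sup>2)" for n z
  have mass: "hardy_mass \<gamma> \<alpha>1 \<alpha>2 (?f n) = (\<integral>\<^sup>+z. m n z \<partial>lborel)" for n
    unfolding hardy_mass_def
  proof (rule nn_integral_cong_AE)
    show "AE z in lborel. ennreal (hardy_weight \<gamma> \<alpha>1 \<alpha>2 z * ((norm (grushin_grad \<gamma> (rho \<gamma>) z))\<^sup>2 / (rho \<gamma> z)\<^sup>2)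
        * (cmod (?f n z))\<^sup>2) = m n z"
      using AE_fst_nonzero
    proof eventually_elim
      case (elim z)
      show ?case unfolding hardy_mass_weight_eq[OF \<gamma> elim] by (simp add: m_def trial_def)
    qed
  qed
  have lim_mass: "(\<lambda>n. \<integral>\<^sup>+z. m n z \<partial>lborel) \<longlonglongrightarrow> (\<integral>\<^sup>+z. ennreal (?W z * (profile D L (?l 0 z))\<^sup>2) \<partial>lborel)"
  proof (rule nn_integral_dominated_convergence)
    show "AE z in lborel. m n z \<le> ennreal (B\<^sup>2) * (ennreal (?W z) * indicator ?S z)" for n
      using AE_fst_nonzero
    proof eventually_elim
      case (elim z)
      show ?case
      proof (cases "?l 0 z \<le> L")
        case True
        then show ?thesis
          using mult_left_mono[OF B2(1), of "?W z"] by (auto simp: m_def ennreal_mult[symmetric] weight_nonneg mult.commute intro!: ennreal_leI)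
      qed (simp add: m_def vanish elim)
    qed
    have "(\<integral>\<^sup>+z. ennreal (?W z) * indicator ?S z \<partial>lborel) < \<infinity>"
      by (rule nn_integral_weight_sublevel_finite[OF \<gamma>]) (use p D \<gamma> in auto)
    then show "(\<integral>\<^sup>+z. ennreal (B\<^sup>2) * (ennreal (?W z) * indicator ?S z) \<partial>lborel) < \<infinity>"
      by (subst nn_integral_cmult) (auto simp: ennreal_mult_less_top)
    show "AE z in lborel. (\<lambda>n. m n z) \<longlonglongrightarrow> ennreal (?W z * (profile D L (?l 0 z))\<^sup>2)"
      using AE_fst_nonzero
    proof eventually_elim
      case (elim z)
      then show ?case unfolding m_def
        by (intro tendsto_intros isCont_tendsto_compose[OF cont(1)] tendsto_log_gauge[OF e0 _ \<gamma>])
    qed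
  qed (simp_all add: m_def)

  define E where "E n z = ennreal (?w z * ((profile' D L (?l (e n) z))\<^sup>2 * (((norm (fst z))\<^sup>2 + (e n)\<^sup>2) powr \<gamma> / gauge_power \<gamma> (e n) z)))" for n z
  have energy: "hardy_energy \<gamma> \<alpha>1 \<alpha>2 (?f n) \<le> (\<integral>\<^sup>+z. E n z \<partial>lborel)" for n
    unfolding hardy_energy_def
  proof (rule nn_integral_mono_AE)
    show "AE z in lborel. ennreal (hardy_weight \<gamma> \<alpha>1 \<alpha>2 z * ((cmod (radial_deriv_x (?f n) z))\<^sup>2
        + norm (fst z) powr (2 * \<gamma>) * (norm (grad_y (?f n) z))\<^sup>2)) \<le> E n z"
      using AE_fst_nonzero
    proof eventually_elim
      case (elim z)
      show ?case unfolding hardy_weight_eq[OF \<gamma> elim] E_def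
        by (intro ennreal_leI mult_left_mono trial_energy_density_le \<gamma> elim weight_nonneg)
    qed
  qed
  have lim_energy: "(\<lambda>n. \<integral>\<^sup>+z. E n z \<partial>lborel) \<longlonglongrightarrow> (\<integral>\<^sup>+z. ennreal (?W z * (profile' D L (?l 0 z))\<^sup>2) \<partial>lborel)"
  proof (rule nn_integral_dominated_convergence)
    show "AE z in lborel. E n z \<le> ennreal (B\<^sup>2 * exp (2 * L)) * (ennreal (?w z) * indicator ?S z)" for n
      using AE_fst_nonzero
    proof eventually_elim
      case (elim z)
      show ?case
      proof (cases "?l 0 z \<le> L \<and> \<bar>?l (e n) z\<bar> \<le> L")
        case True
        have "((norm (fst z))\<^sup>2 + (e n)\<^sup>2) powr \<gamma> / gauge_power \<gamma> (e n) z \<le> exp (- (2 * ?l (e n) z))"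
          by (rule powr_div_gauge_power_le[OF \<gamma> elim])
        also have "\<dots> \<le> exp (2 * L)" using True by auto
        finally have "(profile' D L (?l (e n) z))\<^sup>2 * (((norm (fst z))\<^sup>2 + (e n)\<^sup>2) powr \<gamma> / gauge_power \<gamma> (e n) z) \<le> B\<^sup>2 * exp (2 * L)"
          using gauge_power_pos_of_fst[OF \<gamma> elim, of "e n"] by (intro mult_mono B2) auto
        from mult_left_mono[OF this weight_nonneg[of \<gamma> ?a ?p z]]
        show ?thesis using True by (auto simp: E_def ennreal_mult[symmetric] weight_nonneg mult.commute intro!: ennreal_leI)
      next
        case False
        then have "profile' D L (?l (e n) z) = 0"
          using vanish(2)[OF elim] profile_eq_0(2)[OF \<open>L > 0\<close>, of "?l (e n) z"] by auto
        then show ?thesis by (simp add: E_def)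
      qed
    qed
    have "(\<integral>\<^sup>+z. ennreal (?w z) * indicator ?S z \<partial>lborel) < \<infinity>"
      by (rule nn_integral_weight_sublevel_finite[OF \<gamma>]) (use p D in auto)
    then show "(\<integral>\<^sup>+z. ennreal (B\<^sup>2 * exp (2 * L)) * (ennreal (?w z) * indicator ?S z) \<partial>lborel) < \<infinity>"
      by (subst nn_integral_cmult) (auto simp: ennreal_mult_less_top)
    show "AE z in lborel. (\<lambda>n. E n z) \<longlonglongrightarrow> ennreal (?W z * (profile' D L (?l 0 z))\<^sup>2)"
      using AE_fst_nonzero
    proof eventually_elim
      case (elim z)
      have "(\<lambda>n. ?w z * ((profile' D L (?l (e n) z))\<^sup>2 * (((norm (fst z))\<^sup>2 + (e n)\<^sup>2) powr \<gamma> / gauge_power \<gamma> (e n) z)))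
        \<longlonglongrightarrow> ?w z * ((profile' D L (?l 0 z))\<^sup>2 * (((norm (fst z))\<^sup>2 + 0\<^sup>2) powr \<gamma> / gauge_power \<gamma> 0 z))"
        using elim gauge_power_pos_of_fst[OF \<gamma> elim, of 0]
        by (intro tendsto_intros isCont_tendsto_compose[OF cont(2)] tendsto_log_gauge[OF e0 _ \<gamma>] tendsto_gauge_power e0) auto
      also have "?w z * ((profile' D L (?l 0 z))\<^sup>2 * (((norm (fst z))\<^sup>2 + 0\<^sup>2) powr \<gamma> / gauge_power \<gamma> 0 z)) = ?W z * (profile' D L (?l 0 z))\<^sup>2"
      proof -
        have "((norm (fst z))\<^sup>2 + 0\<^sup>2) powr \<gamma> = (norm (fst z) powr \<gamma>)\<^sup>2"
          using elim by (simp add: power2_eq_square powr_mult)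
        then show ?thesis unfolding weight_shift[OF \<gamma> elim, symmetric] by simp
      qed
      finally show ?case unfolding E_def by (rule tendsto_ennrealI)
    qed
  qed (simp_all add: E_def)

  have le: "ennreal C * (\<integral>\<^sup>+z. m n z \<partial>lborel) \<le> (\<integral>\<^sup>+z. E n z \<partial>lborel)" for n
  proof -
    have "test_function_on (UNIV - {0}) (?f n)" by (rule test_function_trial[OF \<gamma> \<open>L > 0\<close> e])
    from order_trans[OF hardy[OF this] energy] show ?thesis unfolding mass .
  qed
  have "ennreal C * (\<integral>\<^sup>+z. ennreal (?W z * (profile D L (?l 0 z))\<^sup>2) \<partial>lborel)
      \<le> (\<integral>\<^sup>+z. ennreal (?W z * (profile' D L (?l 0 z))\<^sup>2) \<partial>lborel)"
    by (rule LIMSEQ_le[OF ennreal_tendsto_cmult[OF _ lim_mass] lim_energy]) (use le in auto)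
  then have limit: "ennreal C * (\<integral>\<^sup>+z. ennreal (?W z) * ennreal ((profile D L (?l 0 z))\<^sup>2) \<partial>lborel)
      \<le> (\<integral>\<^sup>+z. ennreal (?W z) * ennreal ((profile' D L (?l 0 z))\<^sup>2) \<partial>lborel)"
    by (simp add: ennreal_mult weight_nonneg)
  obtain c where c: "c > 0" "c < \<infinity>" and polar: "\<And>G. G \<in> borel_measurable borel \<Longrightarrow>
      (\<integral>\<^sup>+z. ennreal (?W z) * G (?l 0 z) \<partial>lborel) = c * (\<integral>\<^sup>+s. G s * ennreal (exp (D * s)) \<partial>lborel)"
    using ex_polar_constant[OF \<gamma>, where 'm='m and 'k='k and a="?a'" and p="?p'" and D=D] p \<gamma> D by auto
  have "c * (ennreal C * (\<integral>\<^sup>+s. ennreal ((profile D L s)\<^sup>2) * ennreal (exp (D * s)) \<partial>lborel))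
      \<le> c * (\<integral>\<^sup>+s. ennreal ((profile' D L s)\<^sup>2) * ennreal (exp (D * s)) \<partial>lborel)"
    using limit polar[of "\<lambda>s. ennreal ((profile D L s)\<^sup>2)"] polar[of "\<lambda>s. ennreal ((profile' D L s)\<^sup>2)"]
    by (simp add: mult.left_commute)
  then show ?thesis using c by (simp add: ennreal_mult_le_mult_iff)
qed

theorem theorem2p5:
  fixes \<gamma> \<alpha>\<^sub>1 \<alpha>\<^sub>2 Q :: real
  assumes "\<gamma> \<ge> 0"
    and "Q = real CARD('m::finite) + (1 + \<gamma>) * real CARD('k::finite)"
    and "Q + \<alpha>\<^sub>1 - 2 > 0"
    and "real CARD('m) + \<gamma> * \<alpha>\<^sub>2 > 0"
  shows "(\<forall>f :: (real^'m) \<times> (real^'k) \<Rightarrow> complex. test_function_on (UNIV - {0}) f \<longrightarrow>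
            hardy_energy \<gamma> \<alpha>\<^sub>1 \<alpha>\<^sub>2 f \<ge> ennreal (((Q + \<alpha>\<^sub>1 - 2) / 2)\<^sup>2) * hardy_mass \<gamma> \<alpha>\<^sub>1 \<alpha>\<^sub>2 f)
       \<and> (\<forall>C :: real. C > ((Q + \<alpha>\<^sub>1 - 2) / 2)\<^sup>2 \<longrightarrow>
            \<not> (\<forall>f :: (real^'m) \<times> (real^'k) \<Rightarrow> complex. test_function_on (UNIV - {0}) f \<longrightarrow>
                  hardy_energy \<gamma> \<alpha>\<^sub>1 \<alpha>\<^sub>2 f \<ge> ennreal C * hardy_mass \<gamma> \<alpha>\<^sub>1 \<alpha>\<^sub>2 f))"
proof (intro conjI allI impI notI)
  define D where "D = Q + \<alpha>\<^sub>1 - 2"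
  have D: "D = real CARD('m) + (1+\<gamma>) * real CARD('k) + \<alpha>\<^sub>1 - 2" "D > 0"
    using assms(2,3) by (simp_all add: D_def)
  fix f :: "(real^'m) \<times> (real^'k) \<Rightarrow> complex"
  assume "test_function_on (UNIV - {0}) f"
  from grushin_hardy_inequality[OF assms(1) D this]
  show "ennreal (((Q + \<alpha>\<^sub>1 - 2) / 2)\<^sup>2) * hardy_mass \<gamma> \<alpha>\<^sub>1 \<alpha>\<^sub>2 f \<le> hardy_energy \<gamma> \<alpha>\<^sub>1 \<alpha>\<^sub>2 f"
    by (simp add: D_def)
next
  define D where "D = Q + \<alpha>\<^sub>1 - 2"
  have D: "D = real CARD('m) + (1+\<gamma>) * real CARD('k) + \<alpha>\<^sub>1 - 2" "D > 0"
    using assms(2,3) by (simp_all add: D_def)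
  fix C :: real
  assume "((Q + \<alpha>\<^sub>1 - 2) / 2)\<^sup>2 < C"
  then have "(D / 2)\<^sup>2 < C" by (simp add: D_def)
  from ex_profile_nearly_optimal[OF D(2) this] obtain L where L: "L > 0"
    and less: "(\<integral>\<^sup>+s. ennreal ((profile' D L s)\<^sup>2) * ennreal (exp (D * s)) \<partial>lborel)
      < ennreal C * (\<integral>\<^sup>+s. ennreal ((profile D L s)\<^sup>2) * ennreal (exp (D * s)) \<partial>lborel)"
    by blast
  assume "\<forall>f :: (real^'m) \<times> (real^'k) \<Rightarrow> complex. test_function_on (UNIV - {0}) f \<longrightarrow>
      ennreal C * hardy_mass \<gamma> \<alpha>\<^sub>1 \<alpha>\<^sub>2 f \<le> hardy_energy \<gamma> \<alpha>\<^sub>1 \<alpha>\<^sub>2 f"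
  with hardy_constant_bounds_profile[OF assms(1,4) D L, of C] less show False by (simp add: not_le[symmetric])
qed

end
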